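(* Let $(X,\mu,T)$ be an ergodic $\mathbb{G}$-MPS. Then $H_{ap}^c=H_{ms}$; that is, a function $f\in L^2(X,\mu)$ is $\mu$-mean sensitive if and only if it is not almost periodic.
   Context: $\mathbb{G}$ is a locally compact abelian group (written additively, identity $e$) with Haar measure $\nu$. A $\mathbb{G}$-MPS $(X,\mu,T)$ is a standard probability space $(X,\Sigma,\mu)$ with a (jointly measurable) group action $T:\mathbb{G}\times X\to X$, $(j,x)\mapsto T^jx$, such that every $T^j$ preserves $\mu$; it is ergodic if every measurable set invariant under all $T^j$ has measure $0$ or $1$. A Følner sequence is a sequence $(F_n)_{n\in\mathbb{N}}$ of measurable subsets of $\mathbb{G}$ with $0<\nu(F_n)<\infty$ and $\nu((g+F_n)\triangle F_n)/\nu(F_n)\to 0$ for every $g\in\mathbb{G}$. A Følner sequence $(F_n)$ is fixed that satisfies the pointwise ergodic theorem: for every ergodic $\mathbb{G}$-MPS and every $f\in L^1(X,\mu)$, for $\mu$-a.e. $x$, $\frac{1}{\nu(F_n)}\int_{F_n} f(T^jx)\,d\nu(j)\to\int f\,d\mu$; a point $x$ at which this convergence holds is called generic for $f$. $L^2(X,\mu)$ consists of complex-valued functions, and $U^jf=f\circ T^j$. $f\in L^2(X,\mu)$ is almost periodic if the closure of $\{U^jf:j\in\mathbb{G}\}$ in $L^2(X,\mu)$ is compact; $H_{ap}$ is the set of almost periodic functions and $H_{ap}^c$ its complement in $L^2(X,\mu)$. For $f\in L^2(X,\mu)$ (a fixed representative) define $d_f(x,y)=\limsup_n\left(\frac{1}{\nu(F_n)}\int_{F_n}|f(T^jx)-f(T^jy)|^2d\nu(j)\right)^{1/2}$;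 whenever $d_f$ is used, only points generic for $|f|^2$ (a set of full measure) are considered. $f$ is $\mu$-mean sensitive if there is $\varepsilon>0$ such that for every $A\in\Sigma$ with $\mu(A)>0$ there exist $x,y\in A$ with $d_f(x,y)>\varepsilon$; $H_{ms}$ is the set of $\mu$-mean sensitive functions in $L^2(X,\mu)$. *)

theory Defs
  imports "HOL-Probability.Probability"
begin

text \<open>
  Haar measure in the sense of a nonzero translation-invariant Radon measure: finite on compact
  sets, outer regular on Borel sets, inner regular on open sets. The group is the whole type.
\<close>

definition haar_measure :: "'g::{topological_ab_group_add, t2_space} measure \<Rightarrow> bool" where
  "haar_measure \<nu> \<longleftrightarrow>
     sets \<nu> = sets borel \<and>
     emeasure \<nu> UNIV \<noteq> 0 \<and>
     (\<forall>g. \<forall>A\<in>sets borel. emeasure \<nu> ((+) g ` A) = emeasure \<nu> A) \<and>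
     (\<forall>K. compact K \<longrightarrow> emeasure \<nu> K < \<infinity>) \<and>
     (\<forall>A\<in>sets borel. emeasure \<nu> A = (INF U\<in>{U. open U \<and> A \<subseteq> U}. emeasure \<nu> U)) \<and>
     (\<forall>U. open U \<longrightarrow> emeasure \<nu> U = (SUP K\<in>{K. compact K \<and> K \<subseteq> U}. emeasure \<nu> K))"

definition folner_sequence ::
    "'g::{topological_ab_group_add, t2_space} measure \<Rightarrow> (nat \<Rightarrow> 'g set) \<Rightarrow> bool" where
  "folner_sequence \<nu> F \<longleftrightarrow>
     (\<forall>n. F n \<in> sets \<nu> \<and> 0 < emeasure \<nu> (F n) \<and> emeasure \<nu> (F n) < \<infinity>) \<and>
     (\<forall>g. (\<lambda>n. measure \<nu> (sym_diff ((+) g ` F n) (F n)) / measure \<nu> (F n)) \<longlonglongrightarrow> 0)"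

definition standard_borel :: "'x measure \<Rightarrow> bool" where
  "standard_borel M \<longleftrightarrow>
     (\<exists>\<tau>. topspace \<tau> = space M \<and> completely_metrizable_space \<tau> \<and> second_countable \<tau> \<and>
          sets M = sigma_sets (space M) {U. openin \<tau> U})"

locale G_MPS = prob_space M
  for M :: "'x measure" and T :: "'g::{topological_ab_group_add, t2_space} \<Rightarrow> 'x \<Rightarrow> 'x" +
  assumes standard: "standard_borel M"
    and measurable_action: "(\<lambda>(j, x). T j x) \<in> borel \<Otimes>\<^sub>M M \<rightarrow>\<^sub>M M"
    and action_zero: "x \<in> space M \<Longrightarrow> T 0 x = x"
    and action_add: "x \<in> space M \<Longrightarrow> T (i + j) x = T i (T j x)"
    and preserves: "distr M M (T j) = M"

definition ergodic_action :: "'x measure \<Rightarrow> ('g \<Rightarrow> 'x \<Rightarrow> 'x) \<Rightarrow> bool" where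
  "ergodic_action M T \<longleftrightarrow>
     (\<forall>A\<in>sets M. (\<forall>j. T j -` A \<inter> space M = A) \<longrightarrow> measure M A = 0 \<or> measure M A = 1)"

text \<open>
  The Bochner integral of a non-integrable function is 0 by convention, so genericity explicitly
  requires the orbit averages to exist. By Fubini this holds at almost every point.
\<close>

definition generic_point ::
    "'g measure \<Rightarrow> (nat \<Rightarrow> 'g set) \<Rightarrow> 'x measure \<Rightarrow> ('g \<Rightarrow> 'x \<Rightarrow> 'x) \<Rightarrow>
     ('x \<Rightarrow> 'b::{banach, second_countable_topology}) \<Rightarrow> 'x \<Rightarrow> bool" where
  "generic_point \<nu> F M T f x \<longleftrightarrow>
     (\<forall>n. set_integrable \<nu> (F n) (\<lambda>j. f (T j x))) \<and>
     (\<lambda>n. (1 / measure \<nu> (F n)) *\<^sub>R (LINT j:F n|\<nu>. f (T j x))) \<longlonglongrightarrow> (LINT x|M. f x)"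

text \<open>
  The pointwise ergodic theorem along \<open>F\<close> for all ergodic systems. HOL cannot quantify over the
  type of the points of a system inside a formula; systems carried by an arbitrary subset of the
  reals, with an arbitrary standard Borel structure on that subset, represent every system up to
  isomorphism, because a standard Borel space injects into the reals
  (lemma \<open>standard_borel_inj_real\<close>) and the whole structure can be transported
  along the injection.
\<close>

definition pointwise_ergodic ::
    "'g::{topological_ab_group_add, t2_space} measure \<Rightarrow> (nat \<Rightarrow> 'g set) \<Rightarrow> bool" where
  "pointwise_ergodic \<nu> F \<longleftrightarrow>
     (\<forall>(M :: real measure) (T :: 'g \<Rightarrow> real \<Rightarrow> real). G_MPS M T \<longrightarrow> ergodic_action M T \<longrightarrow>
        (\<forall>f :: real \<Rightarrow> complex. integrable M f \<longrightarrow> (AE x in M. generic_point \<nu> F M T f x)))"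

lemma standard_borel_inj_real:
  fixes M :: "'x measure"
  assumes "standard_borel M"
  shows "\<exists>h :: 'x \<Rightarrow> real. inj_on h (space M)"
proof -
  obtain \<tau> where \<tau>: "topspace \<tau> = space M" "completely_metrizable_space \<tau>" "second_countable \<tau>"
    using assms unfolding standard_borel_def by blast
  obtain \<B> where \<B>: "countable \<B>" "\<And>V. V \<in> \<B> \<Longrightarrow> openin \<tau> V"
      "\<And>U x. openin \<tau> U \<Longrightarrow> x \<in> U \<Longrightarrow> \<exists>V \<in> \<B>. x \<in> V \<and> V \<subseteq> U"
    using \<tau>(3) unfolding second_countable_def by meson
  have haus: "Hausdorff_space \<tau>"
    using \<tau>(2) completely_metrizable_imp_metrizable_space metrizable_imp_Hausdorff_space by blast
  define e where "e x = to_nat_on \<B> ` {V \<in> \<B>. x \<in> V}" for x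
  have inj_e: "inj_on e (space M)"
  proof (rule inj_onI, rule ccontr)
    fix x y assume xy: "x \<in> space M" "y \<in> space M" "e x = e y" "x \<noteq> y"
    then obtain U V where UV: "openin \<tau> U" "openin \<tau> V" "x \<in> U" "y \<in> V" "disjnt U V"
      using haus unfolding Hausdorff_space_def \<tau>(1) by meson
    obtain W where W: "W \<in> \<B>" "x \<in> W" "W \<subseteq> U" using \<B>(3) UV by blast
    then have "to_nat_on \<B> W \<in> e y" using xy(3) unfolding e_def by blast
    then obtain W' where "W' \<in> \<B>" "y \<in> W'" "to_nat_on \<B> W = to_nat_on \<B> W'"
      unfolding e_def by blast
    then have "y \<in> W" using W inj_on_to_nat_on[OF \<B>(1)] by (metis inj_onD)
    then show False using UV W by (auto simp: disjnt_def)
  qed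
  obtain g :: "nat set \<Rightarrow> real" where g: "inj g"
    using nat_sets_eqpoll_reals unfolding eqpoll_def bij_betw_def by blast
  have "inj_on (g \<circ> e) (space M)"
    using inj_e g by (meson comp_inj_on inj_on_subset subset_UNIV)
  then show ?thesis by blast
qed

definition L2_fun :: "'x measure \<Rightarrow> ('x \<Rightarrow> complex) set" where
  "L2_fun M = {f \<in> borel_measurable M. integrable M (\<lambda>x. (cmod (f x))\<^sup>2)}"

definition L2_rel :: "'x measure \<Rightarrow> (('x \<Rightarrow> complex) \<times> ('x \<Rightarrow> complex)) set" where
  "L2_rel M = {(f, g). f \<in> L2_fun M \<and> g \<in> L2_fun M \<and> (AE x in M. f x = g x)}"

definition L2_space :: "'x measure \<Rightarrow> ('x \<Rightarrow> complex) set set" where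
  "L2_space M = L2_fun M // L2_rel M"

definition L2_class :: "'x measure \<Rightarrow> ('x \<Rightarrow> complex) \<Rightarrow> ('x \<Rightarrow> complex) set" where
  "L2_class M f = L2_rel M `` {f}"

definition L2_dist :: "'x measure \<Rightarrow> ('x \<Rightarrow> complex) set \<Rightarrow> ('x \<Rightarrow> complex) set \<Rightarrow> real" where
  "L2_dist M A B =
     (let f = SOME f. f \<in> A; g = SOME g. g \<in> B in sqrt (LINT x|M. (cmod (f x - g x))\<^sup>2))"

abbreviation L2_topology :: "'x measure \<Rightarrow> ('x \<Rightarrow> complex) set topology" where
  "L2_topology M \<equiv> Metric_space.mtopology (L2_space M) (L2_dist M)"

lemma equiv_L2_rel: "equiv (L2_fun M) (L2_rel M)"
  by (rule equivI) (auto simp: L2_rel_def refl_on_def sym_def trans_def elim: AE_mp)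

lemma L2_class_in_space: "f \<in> L2_fun M \<Longrightarrow> L2_class M f \<in> L2_space M"
  by (simp add: L2_class_def L2_space_def quotientI)

lemma L2_space_cases:
  assumes "A \<in> L2_space M"
  obtains f where "f \<in> L2_fun M" "A = L2_class M f"
  using assms by (auto simp: L2_class_def L2_space_def elim: quotientE)

lemma L2_class_eq_iff:
  assumes "f \<in> L2_fun M" "g \<in> L2_fun M"
  shows "L2_class M f = L2_class M g \<longleftrightarrow> (AE x in M. f x = g x)"
  using eq_equiv_class_iff[OF equiv_L2_rel assms] assms
  by (simp add: L2_class_def L2_rel_def)

lemma L2_fun_diff:
  assumes "f \<in> L2_fun M" "g \<in> L2_fun M"
  shows "(\<lambda>x. f x - g x) \<in> L2_fun M"
proof -
  have m: "f \<in> borel_measurable M" "g \<in> borel_measurable M"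
    and i: "integrable M (\<lambda>x. (cmod (f x))\<^sup>2)" "integrable M (\<lambda>x. (cmod (g x))\<^sup>2)"
    using assms by (auto simp: L2_fun_def)
  have "integrable M (\<lambda>x. (cmod (f x - g x))\<^sup>2)"
  proof (rule Bochner_Integration.integrable_bound)
    show "integrable M (\<lambda>x. 2 * (cmod (f x))\<^sup>2 + 2 * (cmod (g x))\<^sup>2)" using i by simp
    show "(\<lambda>x. (cmod (f x - g x))\<^sup>2) \<in> borel_measurable M" using m by measurable
    have "(cmod (a - b))\<^sup>2 \<le> 2 * (cmod a)\<^sup>2 + 2 * (cmod b)\<^sup>2" for a b :: complex
    proof -
      have "(cmod (a - b))\<^sup>2 \<le> (cmod a + cmod b)\<^sup>2"
        by (intro power_mono norm_triangle_ineq4) auto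
      also have "\<dots> \<le> 2 * (cmod a)\<^sup>2 + 2 * (cmod b)\<^sup>2"
        using sum_squares_bound[of "cmod a" "cmod b"] by (simp add: power2_sum)
      finally show ?thesis .
    qed
    then show "AE x in M. norm ((cmod (f x - g x))\<^sup>2)
        \<le> norm (2 * (cmod (f x))\<^sup>2 + 2 * (cmod (g x))\<^sup>2)"
      by (intro AE_I2) (auto intro: order_trans[OF _ abs_ge_self])
  qed
  then show ?thesis using m by (auto simp: L2_fun_def)
qed

lemma L2_dist_class:
  assumes f: "f \<in> L2_fun M" and g: "g \<in> L2_fun M"
  shows "L2_dist M (L2_class M f) (L2_class M g) = sqrt (LINT x|M. (cmod (f x - g x))\<^sup>2)"
proof -
  define f' g' where "f' = (SOME h. h \<in> L2_class M f)" and "g' = (SOME h. h \<in> L2_class M g)"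
  have "f' \<in> L2_class M f"
    unfolding f'_def by (rule someI[of _ f]) (use f in \<open>simp add: L2_class_def L2_rel_def\<close>)
  moreover have "g' \<in> L2_class M g"
    unfolding g'_def by (rule someI[of _ g]) (use g in \<open>simp add: L2_class_def L2_rel_def\<close>)
  ultimately have *: "f' \<in> L2_fun M" "g' \<in> L2_fun M" "AE x in M. f x = f' x" "AE x in M. g x = g' x"
    by (auto simp: L2_class_def L2_rel_def)
  have m: "f \<in> borel_measurable M" "g \<in> borel_measurable M" "f' \<in> borel_measurable M"
      "g' \<in> borel_measurable M"
    using f g * by (auto simp: L2_fun_def)
  have "(LINT x|M. (cmod (f' x - g' x))\<^sup>2) = (LINT x|M. (cmod (f x - g x))\<^sup>2)"
  proof (rule integral_cong_AE)
    show "AE x in M. (cmod (f' x - g' x))\<^sup>2 = (cmod (f x - g x))\<^sup>2" using *(3,4) by eventually_elim simp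
  qed (use m in measurable)
  then show ?thesis by (simp add: L2_dist_def f'_def g'_def)
qed

lemma L2_minkowski:
  assumes f: "f \<in> L2_fun M" and g: "g \<in> L2_fun M" and h: "h \<in> L2_fun M"
  shows "sqrt (LINT x|M. (cmod (f x - h x))\<^sup>2)
    \<le> sqrt (LINT x|M. (cmod (f x - g x))\<^sup>2) + sqrt (LINT x|M. (cmod (g x - h x))\<^sup>2)"
proof -
  define a b where "a = sqrt (LINT x|M. (cmod (f x - g x))\<^sup>2)"
    and "b = sqrt (LINT x|M. (cmod (g x - h x))\<^sup>2)"
  have ab: "0 \<le> a" "0 \<le> b" "a\<^sup>2 = (LINT x|M. (cmod (f x - g x))\<^sup>2)"
      "b\<^sup>2 = (LINT x|M. (cmod (g x - h x))\<^sup>2)"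
    by (auto simp: a_def b_def)
  have i: "integrable M (\<lambda>x. (cmod (f x - g x))\<^sup>2)" "integrable M (\<lambda>x. (cmod (g x - h x))\<^sup>2)"
      "integrable M (\<lambda>x. (cmod (f x - h x))\<^sup>2)"
    using L2_fun_diff f g h unfolding L2_fun_def by blast+
  have pt: "(cmod (u - w))\<^sup>2 \<le> (p + q) / p * (cmod (u - v))\<^sup>2 + (p + q) / q * (cmod (v - w))\<^sup>2"
    if "0 < p" "0 < q" for p q :: real and u v w :: complex
  proof -
    define s t where "s = cmod (u - v)" and "t = cmod (v - w)"
    have "(cmod (u - w))\<^sup>2 \<le> (s + t)\<^sup>2"
      unfolding s_def t_def by (intro power_mono norm_triangle_sub norm_ge_zero)
        (metis norm_triangle_ineq diff_add_cancel add_diff_eq)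
    also have "(p + q) / p * s\<^sup>2 + (p + q) / q * t\<^sup>2 - (s + t)\<^sup>2 = (q * s - p * t)\<^sup>2 / (p * q)"
      using that by (simp add: field_simps power2_eq_square)
    then have "(s + t)\<^sup>2 \<le> (p + q) / p * s\<^sup>2 + (p + q) / q * t\<^sup>2"
      using that by (smt (verit) divide_nonneg_pos mult_pos_pos zero_le_power2)
    finally show ?thesis by (simp add: s_def t_def)
  qed
  have bound: "(LINT x|M. (cmod (f x - h x))\<^sup>2) \<le> (p + q)\<^sup>2" if pq: "a < p" "b < q" for p q
  proof -
    have pos: "0 < p" "0 < q" using pq ab by auto
    have "(LINT x|M. (cmod (f x - h x))\<^sup>2)
        \<le> (LINT x|M. (p + q) / p * (cmod (f x - g x))\<^sup>2 + (p + q) / q * (cmod (g x - h x))\<^sup>2)"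
      by (intro integral_mono i Bochner_Integration.integrable_add integrable_mult_right
          pt pos)
    also have "\<dots> = (p + q) / p * a\<^sup>2 + (p + q) / q * b\<^sup>2"
      using i by (simp add: ab)
    also have "\<dots> \<le> (p + q) / p * p\<^sup>2 + (p + q) / q * q\<^sup>2"
      using pq pos ab by (intro add_mono mult_left_mono power_mono) auto
    also have "\<dots> = (p + q)\<^sup>2"
      using pos by (simp add: field_simps power2_eq_square)
    finally show ?thesis .
  qed
  have "sqrt (LINT x|M. (cmod (f x - h x))\<^sup>2) \<le> a + b"
  proof (rule field_le_epsilon)
    fix e :: real assume "0 < e"
    then have "(LINT x|M. (cmod (f x - h x))\<^sup>2) \<le> (a + e / 2 + (b + e / 2))\<^sup>2"
      by (intro bound) auto
    then have "sqrt (LINT x|M. (cmod (f x - h x))\<^sup>2) \<le> a + e / 2 + (b + e / 2)"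
      using ab \<open>0 < e\<close> by (intro real_le_lsqrt) auto
    then show "sqrt (LINT x|M. (cmod (f x - h x))\<^sup>2) \<le> a + b + e" by simp
  qed
  then show ?thesis by (simp add: a_def b_def)
qed

lemma Metric_space_L2: "Metric_space (L2_space M) (L2_dist M)"
proof
  fix A B :: "('a \<Rightarrow> complex) set"
  show "0 \<le> L2_dist M A B" by (simp add: L2_dist_def Let_def)
  show "L2_dist M A B = L2_dist M B A" by (simp add: L2_dist_def Let_def norm_minus_commute)
next
  fix A B assume "A \<in> L2_space M" "B \<in> L2_space M"
  then obtain f g where fg: "f \<in> L2_fun M" "g \<in> L2_fun M" "A = L2_class M f" "B = L2_class M g"
    by (metis L2_space_cases)
  have "integrable M (\<lambda>x. (cmod (f x - g x))\<^sup>2)"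
    using L2_fun_diff[OF fg(1,2)] by (simp add: L2_fun_def)
  then show "L2_dist M A B = 0 \<longleftrightarrow> A = B"
    using fg by (simp add: L2_dist_class L2_class_eq_iff integral_nonneg_eq_0_iff_AE)
next
  fix A B C assume "A \<in> L2_space M" "B \<in> L2_space M" "C \<in> L2_space M"
  then obtain f g h where "f \<in> L2_fun M" "g \<in> L2_fun M" "h \<in> L2_fun M"
      "A = L2_class M f" "B = L2_class M g" "C = L2_class M h"
    by (metis L2_space_cases)
  then show "L2_dist M A C \<le> L2_dist M A B + L2_dist M B C"
    by (simp add: L2_dist_class L2_minkowski)
qed

definition almost_periodic ::
    "'x measure \<Rightarrow> ('g \<Rightarrow> 'x \<Rightarrow> 'x) \<Rightarrow> ('x \<Rightarrow> complex) \<Rightarrow> bool" where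
  "almost_periodic M T f \<longleftrightarrow>
     compactin (L2_topology M) (L2_topology M closure_of range (\<lambda>j. L2_class M (f \<circ> T j)))"

definition H_ap :: "'x measure \<Rightarrow> ('g \<Rightarrow> 'x \<Rightarrow> 'x) \<Rightarrow> ('x \<Rightarrow> complex) set" where
  "H_ap M T = {f \<in> L2_fun M. almost_periodic M T f}"

definition d_mean ::
    "'g measure \<Rightarrow> (nat \<Rightarrow> 'g set) \<Rightarrow> ('g \<Rightarrow> 'x \<Rightarrow> 'x) \<Rightarrow> ('x \<Rightarrow> complex) \<Rightarrow> 'x \<Rightarrow> 'x \<Rightarrow> ereal"
  where
  "d_mean \<nu> F T f x y =
     limsup (\<lambda>n. ereal (sqrt
       (1 / measure \<nu> (F n) * (LINT j:F n|\<nu>. (cmod (f (T j x) - f (T j y)))\<^sup>2))))"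

text \<open>At points generic for \<open>|f|\<^sup>2\<close> all integrals in \<open>d_mean\<close> exist.\<close>

definition mean_sensitive ::
    "'g measure \<Rightarrow> (nat \<Rightarrow> 'g set) \<Rightarrow> 'x measure \<Rightarrow> ('g \<Rightarrow> 'x \<Rightarrow> 'x) \<Rightarrow> ('x \<Rightarrow> complex) \<Rightarrow> bool"
  where
  "mean_sensitive \<nu> F M T f \<longleftrightarrow>
     (\<exists>\<epsilon>>0. \<forall>A\<in>sets M. measure M A > 0 \<longrightarrow>
        (\<exists>x\<in>A. \<exists>y\<in>A. generic_point \<nu> F M T (\<lambda>z. (cmod (f z))\<^sup>2) x \<and>
           generic_point \<nu> F M T (\<lambda>z. (cmod (f z))\<^sup>2) y \<and>
           d_mean \<nu> F T f x y > ereal \<epsilon>))"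

definition H_ms ::
    "'g measure \<Rightarrow> (nat \<Rightarrow> 'g set) \<Rightarrow> 'x measure \<Rightarrow> ('g \<Rightarrow> 'x \<Rightarrow> 'x) \<Rightarrow> ('x \<Rightarrow> complex) set" where
  "H_ms \<nu> F M T = {f \<in> L2_fun M. mean_sensitive \<nu> F M T f}"

end

theory Submission
  imports Defs
begin

text \<open>
  Suppose \<open>f\<close> is not mean sensitive and let \<open>A\<close> be a set of positive measure on which
  \<open>d\<^sub>f \<le> \<epsilon>\<close>. If \<open>A \<inter> T\<^sup>-\<^sup>j A\<close> is not null, then for almost every \<open>x\<close> in it the pointwise
  ergodic theorem gives \<open>\<parallel>f - U\<^sup>j f\<parallel> = d\<^sub>f(x, T\<^sup>j x) \<le> \<epsilon>\<close>. Since only finitely many translates of \<open>A\<close> can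
  be disjoint up to null sets, the orbit of \<open>f\<close> is totally bounded.

  Conversely, let \<open>f\<close> be almost periodic, and bounded without loss of generality. A finite net of
  its orbit gives information on \<open>f(T\<^sup>j x)\<close> in the mean of \<open>x\<close> only, which does not bound an upper
  limit at individual points. So \<open>f\<close> is replaced by a function \<open>g\<close> close to it in \<open>L\<^sup>2\<close> with
  \<open>|g(T\<^sup>k x) - g(T\<^sup>l x)| \<le> C \<parallel>U\<^sup>k f - U\<^sup>l f\<parallel>\<close> for all \<open>x\<close>. Then finitely many functions \<open>g \<circ> T\<^sup>k\<close>
  approximate all \<open>g \<circ> T\<^sup>j\<close> uniformly; on a set of positive measure where they vary by at most
  \<open>\<epsilon>\<close> the pseudometric \<open>d\<^sub>g\<close> is small, and \<open>d\<^sub>f \<le> d\<^sub>g + 2 \<parallel>f - g\<parallel>\<close> at generic points.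
\<close>

section \<open>The space \<open>L\<^sup>2\<close> of a probability measure\<close>

text \<open>The L2 distance is taken on representatives instead of classes, so that it applies
  equally to functions on \<open>M\<close> and to orbit functions on the group. If the square is not
  integrable, the value is 0 by the convention for the Bochner integral.\<close>

definition L2_gap :: "'x measure \<Rightarrow> ('x \<Rightarrow> complex) \<Rightarrow> ('x \<Rightarrow> complex) \<Rightarrow> real" where
  "L2_gap M f g = sqrt (LINT x|M. (cmod (f x - g x))\<^sup>2)"

lemma L2_gap_nonneg [simp]: "0 \<le> L2_gap M f g"
  by (simp add: L2_gap_def)

lemma L2_gap_self [simp]: "L2_gap M f f = 0"
  by (simp add: L2_gap_def)

lemma L2_gap_commute: "L2_gap M f g = L2_gap M g f"
  by (simp add: L2_gap_def norm_minus_commute)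

lemma L2_gap_triangle:
  assumes "f \<in> L2_fun M" "g \<in> L2_fun M" "h \<in> L2_fun M"
  shows "L2_gap M f h \<le> L2_gap M f g + L2_gap M g h"
  using L2_minkowski[OF assms] by (simp add: L2_gap_def)

lemma L2_gap_power2: "(L2_gap M f g)\<^sup>2 = (LINT x|M. (cmod (f x - g x))\<^sup>2)"
  by (simp add: L2_gap_def)

lemma L2_fun_measurable: "f \<in> L2_fun M \<Longrightarrow> f \<in> borel_measurable M"
  by (simp add: L2_fun_def)

lemma L2_fun_diff_integrable:
  "f \<in> L2_fun M \<Longrightarrow> g \<in> L2_fun M \<Longrightarrow> integrable M (\<lambda>x. (cmod (f x - g x))\<^sup>2)"
  using L2_fun_diff[of f M g] by (simp add: L2_fun_def)

lemma L2_gap_mono: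
  assumes "f' \<in> L2_fun M" "g' \<in> L2_fun M"
    and "\<And>x. x \<in> space M \<Longrightarrow> cmod (f x - g x) \<le> cmod (f' x - g' x)"
  shows "L2_gap M f g \<le> L2_gap M f' g'"
proof (cases "integrable M (\<lambda>x. (cmod (f x - g x))\<^sup>2)")
  case True
  then show ?thesis
    unfolding L2_gap_def
    by (intro real_sqrt_le_mono integral_mono power_mono)
       (use assms in \<open>auto intro: L2_fun_diff_integrable\<close>)
next
  \<comment> \<open>A square that is not integrable has integral 0, and the estimate becomes
    trivial.\<close>
  case False
  then have "L2_gap M f g = 0" by (simp add: L2_gap_def not_integrable_integral_eq)
  then show ?thesis by simp
qed

lemma L2_fun_bounded:
  assumes "finite_measure M" "f \<in> borel_measurable M" "\<And>x. x \<in> space M \<Longrightarrow> cmod (f x) \<le> B"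
  shows "f \<in> L2_fun M"
proof -
  interpret finite_measure M by fact
  have "integrable M (\<lambda>x. (cmod (f x))\<^sup>2)"
    by (rule integrable_const_bound[where B="B\<^sup>2"])
       (use assms in \<open>auto intro!: AE_I2 power_mono\<close>)
  then show ?thesis using assms by (simp add: L2_fun_def)
qed

lemma (in prob_space) L2_gap_le_const:
  assumes "\<And>x. x \<in> space M \<Longrightarrow> cmod (f x - g x) \<le> B" "0 \<le> B"
  shows "L2_gap M f g \<le> B"
proof (cases "integrable M (\<lambda>x. (cmod (f x - g x))\<^sup>2)")
  case True
  have "(LINT x|M. (cmod (f x - g x))\<^sup>2) \<le> (LINT x|M. B\<^sup>2)"
    by (rule integral_mono[OF True]) (use assms in \<open>auto intro!: power_mono\<close>)
  then show ?thesis
    using assms(2) unfolding L2_gap_def by (intro real_le_lsqrt) (auto simp: prob_space)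
next
  case False
  then have "L2_gap M f g = 0" by (simp add: L2_gap_def not_integrable_integral_eq)
  then show ?thesis using assms(2) by simp
qed

text \<open>Cauchy-Schwarz against the constant 1, in the form that the variance of
  \<open>cmod (f x - g x)\<close> is nonnegative.\<close>

lemma (in prob_space) L1_le_L2_gap:
  assumes "f \<in> L2_fun M" "g \<in> L2_fun M"
  shows "(LINT x|M. cmod (f x - g x)) \<le> L2_gap M f g"
    and "integrable M (\<lambda>x. cmod (f x - g x))"
proof -
  have [measurable]: "f \<in> borel_measurable M" "g \<in> borel_measurable M"
    using assms by (auto simp: L2_fun_def)
  have i2: "integrable M (\<lambda>x. (cmod (f x - g x))\<^sup>2)"
    using assms by (rule L2_fun_diff_integrable)
  show i1: "integrable M (\<lambda>x. cmod (f x - g x))"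
    by (rule square_integrable_imp_integrable) (use i2 in auto)
  have "0 \<le> variance (\<lambda>x. cmod (f x - g x))" by (rule variance_positive)
  then have "(LINT x|M. cmod (f x - g x))\<^sup>2 \<le> (LINT x|M. (cmod (f x - g x))\<^sup>2)"
    using variance_eq[OF i1 i2] by simp
  then show "(LINT x|M. cmod (f x - g x)) \<le> L2_gap M f g"
    unfolding L2_gap_def by (rule real_le_rsqrt)
qed

text \<open>The L1 norms of the increments are dominated by a geometric series. By monotone
  convergence the increments are absolutely summable at almost every point, and their partial sums
  telescope.\<close>

lemma (in prob_space) AE_convergent_of_summable_L2_gap:
  fixes f :: "nat \<Rightarrow> 'a \<Rightarrow> complex"
  assumes f: "\<And>n. f n \<in> L2_fun M" and gap: "\<And>n. L2_gap M (f n) (f (Suc n)) \<le> (1/2)^n"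
  shows "AE x in M. convergent (\<lambda>n. f n x)"
proof -
  have [measurable]: "\<And>n. f n \<in> borel_measurable M" using f by (simp add: L2_fun_def)
  have le: "(\<integral>\<^sup>+x. ennreal (cmod (f (Suc n) x - f n x)) \<partial>M) \<le> ennreal ((1/2)^n)" for n
  proof -
    have "(\<integral>\<^sup>+x. ennreal (cmod (f (Suc n) x - f n x)) \<partial>M)
        = ennreal (LINT x|M. cmod (f (Suc n) x - f n x))"
      by (rule nn_integral_eq_integral[OF L1_le_L2_gap(2)[OF f f]]) auto
    also have "\<dots> \<le> ennreal ((1/2)^n)"
      using L1_le_L2_gap(1)[OF f f, of "Suc n" n] gap[of n]
      by (intro ennreal_leI) (simp add: L2_gap_commute)
    finally show ?thesis .
  qed
  have "(\<integral>\<^sup>+x. (\<Sum>n. ennreal (cmod (f (Suc n) x - f n x))) \<partial>M)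
      = (\<Sum>n. \<integral>\<^sup>+x. ennreal (cmod (f (Suc n) x - f n x)) \<partial>M)"
    by (rule nn_integral_suminf) simp
  also have "\<dots> \<le> (\<Sum>n. ennreal ((1/2)^n))"
    by (intro suminf_le le) auto
  also have "\<dots> < \<infinity>"
    by (subst suminf_ennreal2) (auto intro!: summable_geometric)
  finally have "AE x in M. (\<Sum>n. ennreal (cmod (f (Suc n) x - f n x))) \<noteq> \<infinity>"
    by (intro nn_integral_PInf_AE) auto
  then show ?thesis
  proof eventually_elim
    case (elim x)
    then have "summable (\<lambda>n. cmod (f (Suc n) x - f n x))"
      by (intro summable_suminf_not_top) auto
    then have "summable (\<lambda>n. f (Suc n) x - f n x)" by (rule summable_norm_cancel)
    then have "convergent (\<lambda>n. \<Sum>i<n. f (Suc i) x - f i x)"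
      by (simp add: summable_iff_convergent)
    then have "convergent (\<lambda>n. f n x - f 0 x)"
      by (simp only: sum_lessThan_telescope[of "\<lambda>i. f i x"])
    then show ?case
      by (simp add: convergent_diff_const_right_iff)
  qed
qed

text \<open>The Riesz-Fischer argument: a fast subsequence converges almost everywhere, and Fatou's
  lemma makes its limit the L2 limit of the whole sequence. The almost everywhere statement is kept
  because the approximating function is later built from pointwise upper limits.\<close>

lemma (in prob_space) L2_Cauchy_subseq:
  fixes f :: "nat \<Rightarrow> 'a \<Rightarrow> complex"
  assumes f: "\<And>n. f n \<in> L2_fun M"
    and Cauchy: "\<And>e. 0 < e \<Longrightarrow> \<exists>N. \<forall>m\<ge>N. \<forall>n\<ge>N. L2_gap M (f m) (f n) < e"
  obtains r g where "strict_mono r" "g \<in> L2_fun M"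
    "AE x in M. (\<lambda>k. f (r k) x) \<longlonglongrightarrow> g x" "(\<lambda>n. L2_gap M (f n) g) \<longlonglongrightarrow> 0"
proof -
  have [measurable]: "\<And>n. f n \<in> borel_measurable M" using f by (simp add: L2_fun_def)
  define N where "N k = (SOME N. \<forall>m\<ge>N. \<forall>n\<ge>N. L2_gap M (f m) (f n) < (1/2)^k)" for k :: nat
  have N: "L2_gap M (f m) (f n) < (1/2)^k" if "N k \<le> m" "N k \<le> n" for k m n
    using someI_ex[OF Cauchy[of "(1/2)^k"]] that unfolding N_def by auto
  \<comment> \<open>The maximum makes \<open>r\<close> strictly increasing and gives
    \<open>N k \<le> r k\<close>, so consecutive members of the subsequence are closer than
    \<open>(1/2)^k\<close>.\<close>
  define r where "r = rec_nat (N 0) (\<lambda>k m. max (Suc m) (N (Suc k)))"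
  have r_Suc: "r (Suc k) = max (Suc (r k)) (N (Suc k))" for k by (simp add: r_def)
  have r: "strict_mono r" by (rule strict_monoI_Suc) (simp add: r_Suc)
  have rN: "N k \<le> r k" for k by (cases k) (auto simp: r_def)
  have "AE x in M. convergent (\<lambda>k. f (r k) x)"
  proof (rule AE_convergent_of_summable_L2_gap)
    fix n
    have "N n \<le> r (Suc n)" using rN[of n] r by (meson le_trans lessI less_imp_le strict_mono_less_eq)
    then show "L2_gap M (f (r n)) (f (r (Suc n))) \<le> (1/2)^n"
      using N[OF rN[of n], of "r (Suc n)"] by simp
  qed (rule f)
  moreover define g where "g x = lim (\<lambda>k. f (r k) x)" for x
  ultimately have lim: "AE x in M. (\<lambda>k. f (r k) x) \<longlonglongrightarrow> g x"
    by (auto simp: g_def convergent_LIMSEQ_iff elim!: AE_mp)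
  have [measurable]: "g \<in> borel_measurable M"
    unfolding g_def by (rule borel_measurable_lim_metric) simp
  \<comment> \<open>Fatou's lemma along the subsequence: a bound on the distances from
    \<open>f n\<close> to all late members passes to the limit \<open>g\<close>. The shift by
    \<open>n0\<close> keeps every index that occurs above \<open>n0\<close>.\<close>
  have fatou: "(\<integral>\<^sup>+x. ennreal ((cmod (f n x - g x))\<^sup>2) \<partial>M) \<le> ennreal (e\<^sup>2)"
    if e: "\<And>m. n0 \<le> m \<Longrightarrow> L2_gap M (f n) (f m) \<le> e" for n n0 e
  proof -
    have "(\<integral>\<^sup>+x. ennreal ((cmod (f n x - g x))\<^sup>2) \<partial>M)
        = (\<integral>\<^sup>+x. liminf (\<lambda>k. ennreal ((cmod (f n x - f (r (k + n0)) x))\<^sup>2)) \<partial>M)"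
    proof (rule nn_integral_cong_AE)
      show "AE x in M. ennreal ((cmod (f n x - g x))\<^sup>2)
          = liminf (\<lambda>k. ennreal ((cmod (f n x - f (r (k + n0)) x))\<^sup>2))"
        using lim
      proof eventually_elim
        case (elim x)
        then have "(\<lambda>k. f (r (k + n0)) x) \<longlonglongrightarrow> g x" by (rule LIMSEQ_ignore_initial_segment)
        then have "(\<lambda>k. ennreal ((cmod (f n x - f (r (k + n0)) x))\<^sup>2))
            \<longlonglongrightarrow> ennreal ((cmod (f n x - g x))\<^sup>2)"
          by (intro tendsto_intros)
        then show ?case by (metis lim_imp_Liminf sequentially_bot)
      qed
    qed
    also have "\<dots> \<le> liminf (\<lambda>k. \<integral>\<^sup>+x. ennreal ((cmod (f n x - f (r (k + n0)) x))\<^sup>2) \<partial>M)"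
      by (rule nn_integral_liminf) simp
    also have "\<dots> \<le> liminf (\<lambda>k. ennreal (e\<^sup>2))"
    proof (intro Liminf_mono always_eventually allI)
      fix k
      have "n0 \<le> r (k + n0)" using seq_suble[OF r, of "k + n0"] by simp
      then have "(L2_gap M (f n) (f (r (k + n0))))\<^sup>2 \<le> e\<^sup>2" by (intro power_mono e) auto
      then show "(\<integral>\<^sup>+x. ennreal ((cmod (f n x - f (r (k + n0)) x))\<^sup>2) \<partial>M) \<le> ennreal (e\<^sup>2)"
        by (subst nn_integral_eq_integral)
           (auto intro!: L2_fun_diff_integrable f ennreal_leI simp: L2_gap_power2)
    qed
    also have "\<dots> = ennreal (e\<^sup>2)" by (simp add: Liminf_const)
    finally show ?thesis .
  qed
  \<comment> \<open>Integrability of \<open>g\<close> comes from the case \<open>e = 1\<close>: one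
    difference \<open>f N1 - g\<close> is square integrable, and \<open>g\<close> is
    \<open>f N1\<close> minus it.\<close>
  obtain N1 where "\<forall>m\<ge>N1. \<forall>n\<ge>N1. L2_gap M (f m) (f n) < 1" using Cauchy[of 1] by auto
  then have "(\<integral>\<^sup>+x. ennreal ((cmod (f N1 x - g x))\<^sup>2) \<partial>M) \<le> ennreal (1\<^sup>2)"
    by (intro fatou[of N1]) (auto simp: less_imp_le)
  then have "integrable M (\<lambda>x. (cmod (f N1 x - g x))\<^sup>2)"
    by (intro integrableI_bounded) (auto simp: le_less_trans)
  then have "(\<lambda>x. f N1 x - g x) \<in> L2_fun M" by (simp add: L2_fun_def)
  from L2_fun_diff[OF f[of N1] this] have g: "g \<in> L2_fun M" by simp
  have "(\<lambda>n. L2_gap M (f n) g) \<longlonglongrightarrow> 0"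
  proof (rule LIMSEQ_I)
    fix e :: real assume "0 < e"
    then obtain N0 where N0: "\<forall>m\<ge>N0. \<forall>n\<ge>N0. L2_gap M (f m) (f n) < e/2" using Cauchy[of "e/2"] by auto
    have "L2_gap M (f n) g < e" if "N0 \<le> n" for n
    proof -
      have "(\<integral>\<^sup>+x. ennreal ((cmod (f n x - g x))\<^sup>2) \<partial>M) \<le> ennreal ((e/2)\<^sup>2)"
        by (rule fatou[of N0]) (use N0 that in \<open>auto simp: less_imp_le\<close>)
      then have "(L2_gap M (f n) g)\<^sup>2 \<le> (e/2)\<^sup>2"
        by (subst (asm) nn_integral_eq_integral)
           (auto intro!: L2_fun_diff_integrable f g simp: L2_gap_power2)
      then have "L2_gap M (f n) g \<le> e/2"
        using \<open>0 < e\<close> by (simp add: power2_le_iff_abs_le)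
      then show ?thesis using \<open>0 < e\<close> by simp
    qed
    then show "\<exists>N0. \<forall>n\<ge>N0. norm (L2_gap M (f n) g - 0) < e" by auto
  qed
  then show ?thesis using that r g lim by blast
qed

section \<open>Completeness of L2 and compactness through finite nets\<close>

lemma L2_dist_class_gap:
  "f \<in> L2_fun M \<Longrightarrow> g \<in> L2_fun M \<Longrightarrow> L2_dist M (L2_class M f) (L2_class M g) = L2_gap M f g"
  by (simp add: L2_dist_class L2_gap_def)

lemma (in prob_space) mcomplete_L2: "Metric_space.mcomplete (L2_space M) (L2_dist M)"
proof -
  interpret L: Metric_space "L2_space M" "L2_dist M" by (rule Metric_space_L2)
  show ?thesis
    unfolding L.mcomplete_def
  proof (intro allI impI)
    fix \<sigma> assume \<sigma>: "L.MCauchy \<sigma>"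
    then have "\<forall>n. \<exists>f. f \<in> L2_fun M \<and> \<sigma> n = L2_class M f"
      unfolding L.MCauchy_def by (metis L2_space_cases rangeI subset_iff)
    then obtain f where f: "\<And>n. f n \<in> L2_fun M" "\<And>n. \<sigma> n = L2_class M (f n)" by metis
    have Cauchy: "\<exists>N. \<forall>m\<ge>N. \<forall>n\<ge>N. L2_gap M (f m) (f n) < e" if e: "0 < e" for e
    proof -
      obtain N where "\<And>m n. N \<le> m \<Longrightarrow> N \<le> n \<Longrightarrow> L2_dist M (\<sigma> m) (\<sigma> n) < e"
        using \<sigma> e unfolding L.MCauchy_def by blast
      then show ?thesis by (intro exI[of _ N] allI impI) (simp only: f L2_dist_class_gap)
    qed
    obtain g where g: "g \<in> L2_fun M" "(\<lambda>n. L2_gap M (f n) g) \<longlonglongrightarrow> 0"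
      by (rule L2_Cauchy_subseq[of f, OF f(1) Cauchy])
    have "limitin L.mtopology \<sigma> (L2_class M g) sequentially"
      unfolding L.limit_metric_sequentially
    proof (intro conjI allI impI)
      show "L2_class M g \<in> L2_space M" using g by (simp add: L2_class_in_space)
      fix e :: real assume "0 < e"
      then show "\<exists>N. \<forall>n\<ge>N. \<sigma> n \<in> L2_space M \<and> L2_dist M (\<sigma> n) (L2_class M g) < e"
        using LIMSEQ_D[OF g(2)] by (simp add: f g L2_dist_class_gap L2_class_in_space)
    qed
    then show "\<exists>x. limitin L.mtopology \<sigma> x sequentially" by blast
  qed
qed

text \<open>Total boundedness takes the centres of the balls from the set itself, so a finite set of
  centres is the image of a finite set of indices.\<close>

lemma L2_mtotally_bounded_iff:
  assumes f: "\<And>i. f i \<in> L2_fun M"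
  shows "Metric_space.mtotally_bounded (L2_space M) (L2_dist M) (range (\<lambda>i. L2_class M (f i))) \<longleftrightarrow>
    (\<forall>e>0. \<exists>K. finite K \<and> (\<forall>i. \<exists>k\<in>K. L2_gap M (f k) (f i) < e))" (is "?L \<longleftrightarrow> ?R")
proof -
  interpret L: Metric_space "L2_space M" "L2_dist M" by (rule Metric_space_L2)
  have ball: "L2_class M (f i) \<in> L.mball (L2_class M (f k)) e \<longleftrightarrow> L2_gap M (f k) (f i) < e" for i k e
    using f by (simp add: L2_dist_class_gap L2_class_in_space)
  show ?thesis
  proof
    assume L: ?L
    show ?R
    proof (intro allI impI)
      fix e :: real assume "0 < e"
      then obtain K where K: "finite K" "K \<subseteq> range (\<lambda>i. L2_class M (f i))"
          "range (\<lambda>i. L2_class M (f i)) \<subseteq> (\<Union>x\<in>K. L.mball x e)"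
        using L unfolding L.mtotally_bounded_def by meson
      from finite_subset_image[OF K(1,2)] obtain I where I: "finite I" "K = (\<lambda>i. L2_class M (f i)) ` I"
        by blast
      have "\<exists>k\<in>I. L2_gap M (f k) (f i) < e" for i
        using K(3) ball unfolding I(2) by blast
      then show "\<exists>K. finite K \<and> (\<forall>i. \<exists>k\<in>K. L2_gap M (f k) (f i) < e)" using I by blast
    qed
  next
    assume R: ?R
    show ?L
      unfolding L.mtotally_bounded_def
    proof (intro allI impI)
      fix e :: real assume "0 < e"
      then obtain K where K: "finite K" "\<forall>i. \<exists>k\<in>K. L2_gap M (f k) (f i) < e" using R by blast
      have "L2_class M (f i) \<in> (\<Union>x\<in>(\<lambda>i. L2_class M (f i)) ` K. L.mball x e)" for i
      proof -
        obtain k where "k \<in> K" "L2_gap M (f k) (f i) < e" using K(2) by blast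
        then show ?thesis by (intro UN_I[OF imageI, of k]) (simp_all only: ball)
      qed
      then show "\<exists>K. finite K \<and> K \<subseteq> range (\<lambda>i. L2_class M (f i)) \<and>
          range (\<lambda>i. L2_class M (f i)) \<subseteq> (\<Union>x\<in>K. L.mball x e)"
        using K(1) by (intro exI[of _ "(\<lambda>i. L2_class M (f i)) ` K"]) blast
    qed
  qed
qed

text \<open>In a complete metric space, compact closure and total boundedness coincide. Almost
  periodicity is used below only in this form, as the existence of finite nets of
  translates.\<close>

lemma (in prob_space) almost_periodic_iff:
  assumes "\<And>j. f \<circ> T j \<in> L2_fun M"
  shows "almost_periodic M T f \<longleftrightarrow>
    (\<forall>e>0. \<exists>K. finite K \<and> (\<forall>j. \<exists>k\<in>K. L2_gap M (f \<circ> T k) (f \<circ> T j) < e))"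
proof -
  interpret L: Metric_space "L2_space M" "L2_dist M" by (rule Metric_space_L2)
  have "range (\<lambda>j. L2_class M (f \<circ> T j)) \<subseteq> L2_space M"
    using assms by (auto intro: L2_class_in_space)
  then have "almost_periodic M T f \<longleftrightarrow> L.mtotally_bounded (range (\<lambda>j. L2_class M (f \<circ> T j)))"
    unfolding almost_periodic_def L.mtotally_bounded_eq_compact_closure_of[OF mcomplete_L2] by simp
  then show ?thesis
    using L2_mtotally_bounded_iff[of "\<lambda>j. f \<circ> T j", OF assms] by simp
qed

text \<open>Total boundedness yields a Cauchy subsequence \<open>s\<close>; thinning it out once
  more by \<open>r\<close> adds convergence almost everywhere.\<close>

lemma (in prob_space) L2_totally_bounded_subseq:
  fixes f :: "nat \<Rightarrow> 'a \<Rightarrow> complex"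
  assumes f: "\<And>n. f n \<in> L2_fun M"
    and tb: "\<And>e. 0 < e \<Longrightarrow> \<exists>K. finite K \<and> (\<forall>i. \<exists>k\<in>K. L2_gap M (f k) (f i) < e)"
  obtains r g where "strict_mono r" "g \<in> L2_fun M"
    "AE x in M. (\<lambda>k. f (r k) x) \<longlonglongrightarrow> g x" "(\<lambda>n. L2_gap M (f (r n)) g) \<longlonglongrightarrow> 0"
proof -
  interpret L: Metric_space "L2_space M" "L2_dist M" by (rule Metric_space_L2)
  have "L.mtotally_bounded (range (\<lambda>i. L2_class M (f i)))"
    using L2_mtotally_bounded_iff[of f, OF f] tb by blast
  then obtain s where s: "strict_mono s" "L.MCauchy ((\<lambda>i. L2_class M (f i)) \<circ> s)"
    unfolding L.mtotally_bounded_sequentially by blast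
  have Cauchy: "\<exists>N. \<forall>m\<ge>N. \<forall>n\<ge>N. L2_gap M (f (s m)) (f (s n)) < e" if e: "0 < e" for e
  proof -
    obtain N where "\<And>m n. N \<le> m \<Longrightarrow> N \<le> n \<Longrightarrow> L2_dist M (L2_class M (f (s m))) (L2_class M (f (s n))) < e"
      using s(2) e unfolding L.MCauchy_def o_def by blast
    then show ?thesis by (intro exI[of _ N] allI impI) (simp only: f L2_dist_class_gap)
  qed
  obtain r g where r: "strict_mono r" "g \<in> L2_fun M"
    "AE x in M. (\<lambda>k. f (s (r k)) x) \<longlonglongrightarrow> g x" "(\<lambda>n. L2_gap M (f (s n)) g) \<longlonglongrightarrow> 0"
    by (rule L2_Cauchy_subseq[of "\<lambda>n. f (s n)", OF f Cauchy])
  show ?thesis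
  proof (rule that[of "s \<circ> r" g])
    show "strict_mono (s \<circ> r)" using s r by (simp add: strict_mono_o)
    show "(\<lambda>n. L2_gap M (f ((s \<circ> r) n)) g) \<longlonglongrightarrow> 0"
      using LIMSEQ_subseq_LIMSEQ[OF r(4,1)] by (simp add: o_def)
  qed (use r in auto)
qed

section \<open>Transport of the pointwise ergodic theorem to arbitrary systems\<close>

context
  fixes M :: "'x measure" and h :: "'x \<Rightarrow> real"
  assumes inj: "inj_on h (space M)"
begin

text \<open>The topology is pulled back along the inverse of \<open>h\<close>, which makes
  \<open>h\<close> a homeomorphism onto its image; it need not be the subspace topology of the
  reals. Polishness is a homeomorphism invariant, and generating a sigma-algebra commutes with
  preimages.\<close>

lemma standard_borel_embed_measure:
  assumes "standard_borel M"
  shows "standard_borel (embed_measure M h)"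
proof -
  obtain \<tau> where \<tau>: "topspace \<tau> = space M" "completely_metrizable_space \<tau>" "second_countable \<tau>"
      "sets M = sigma_sets (space M) {U. openin \<tau> U}"
    using assms unfolding standard_borel_def by blast
  let ?h' = "the_inv_into (space M) h"
  define \<tau>' where "\<tau>' = pullback_topology (h ` space M) ?h' \<tau>"
  have op: "openin \<tau>' V \<longleftrightarrow> (\<exists>U. openin \<tau> U \<and> V = h ` U)" for V
  proof -
    have "?h' -` U \<inter> h ` space M = h ` U" if "openin \<tau> U" for U
      by (rule the_inv_into_vimage[OF inj]) (use openin_subset[OF that] \<tau>(1) in simp)
    then show ?thesis unfolding \<tau>'_def openin_pullback_topology by blast
  qed
  have top: "topspace \<tau>' = h ` space M"
    by (auto simp: \<tau>'_def topspace_pullback_topology \<tau>(1) the_inv_into_f_f[OF inj])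
  have "homeomorphic_map \<tau> \<tau>' h"
  proof (rule bijective_open_imp_homeomorphic_map)
    show "open_map \<tau> \<tau>' h" by (auto simp: open_map_def op)
    show "h ` topspace \<tau> = topspace \<tau>'" "inj_on h (topspace \<tau>)"
      by (simp_all add: top \<tau>(1) inj)
    show "continuous_map \<tau> \<tau>' h"
      unfolding continuous_map_def
    proof (intro conjI allI impI)
      fix V assume "openin \<tau>' V"
      then obtain U where U: "openin \<tau> U" "V = h ` U" by (auto simp: op)
      then have "{x \<in> topspace \<tau>. h x \<in> V} = U"
        using openin_subset[OF U(1)] inj unfolding \<tau>(1) by (auto dest: inj_onD)
      then show "openin \<tau> {x \<in> topspace \<tau>. h x \<in> V}" using U by simp
    qed (auto simp: top \<tau>(1))
  qed
  then have hom: "\<tau> homeomorphic_space \<tau>'" by (rule homeomorphic_map_imp_homeomorphic_space)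
  have "sets (embed_measure M h) = sigma_sets (h ` space M) {V. openin \<tau>' V}"
  proof -
    have S: "{U. openin \<tau> U} \<subseteq> Pow (space M)" using openin_subset \<tau>(1) by fastforce
    have "sets (embed_measure M h) = {?h' -` A \<inter> h ` space M |A. A \<in> sets M}"
      unfolding sets_embed_measure'[OF inj]
      using the_inv_into_vimage[OF inj] sets.sets_into_space[of _ M] by metis
    also have "\<dots> = sigma_sets (h ` space M) {?h' -` A \<inter> h ` space M |A. openin \<tau> A}"
      unfolding \<tau>(4)
      using sigma_sets_vimage_commute[OF the_inv_into_in_Pi[OF inj], of "{U. openin \<tau> U}"] by simp
    also have "{?h' -` A \<inter> h ` space M |A. openin \<tau> A} = {V. openin \<tau>' V}"
      by (auto simp: \<tau>'_def openin_pullback_topology)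
    finally show ?thesis .
  qed
  then show ?thesis
    unfolding standard_borel_def space_embed_measure
    using top hom \<tau> homeomorphic_completely_metrizable_space[OF hom]
      homeomorphic_space_second_countability[OF hom] by blast
qed

lemma measurable_the_inv_into_embed:
  "the_inv_into (space M) h \<in> embed_measure M h \<rightarrow>\<^sub>M M"
  by (rule measurable_embed_measure1) (simp add: the_inv_into_f_f[OF inj] cong: measurable_cong)

lemma AE_embed_measureD:
  assumes "AE y in embed_measure M h. P y"
  shows "AE x in M. P (h x)"
proof -
  have "AE y in distr M (embed_measure M h) h. P y"
    using assms by (subst (asm) embed_measure_eq_distr'[OF inj])
  then show ?thesis
    by (rule AE_distrD[rotated]) (rule measurable_embed_measure2'[OF inj])
qed

lemma integral_embed_measure:
  fixes f :: "real \<Rightarrow> 'b::{banach, second_countable_topology}"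
  assumes "f \<in> borel_measurable (embed_measure M h)"
  shows "integrable (embed_measure M h) f \<longleftrightarrow> integrable M (\<lambda>x. f (h x))"
    and "(LINT y|embed_measure M h. f y) = (LINT x|M. f (h x))"
  using integrable_distr_eq[OF measurable_embed_measure2'[OF inj] assms]
    integral_distr[OF measurable_embed_measure2'[OF inj] assms]
  by (simp_all add: embed_measure_eq_distr'[OF inj, symmetric])

end

definition transport :: "'x measure \<Rightarrow> ('x \<Rightarrow> real) \<Rightarrow> ('g \<Rightarrow> 'x \<Rightarrow> 'x) \<Rightarrow> 'g \<Rightarrow> real \<Rightarrow> real" where
  "transport M h T j y = h (T j (the_inv_into (space M) h y))"

context G_MPS
begin

lemma measurable_T [measurable]: "T j \<in> M \<rightarrow>\<^sub>M M"
  using measurable_Pair2[OF measurable_action, of j] by simp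

lemma T_space: "x \<in> space M \<Longrightarrow> T j x \<in> space M"
  using measurable_T by (rule measurable_space)

lemma measurable_orbit: "x \<in> space M \<Longrightarrow> (\<lambda>j. T j x) \<in> borel \<rightarrow>\<^sub>M M"
  using measurable_compose[OF measurable_Pair2' measurable_action] by simp

lemma G_MPS_transport:
  assumes inj: "inj_on h (space M)"
  shows "G_MPS (embed_measure M h) (transport M h T)"
proof -
  let ?h' = "the_inv_into (space M) h" and ?N = "embed_measure M h"
  note [measurable] = measurable_embed_measure2'[OF inj] measurable_the_inv_into_embed[OF inj]
  have eq: "?N = distr M ?N h" by (rule embed_measure_eq_distr'[OF inj])
  interpret N: prob_space ?N
    by (subst eq) (rule prob_space_distr, simp)
  have tr: "transport M h T j (h x) = h (T j x)" if "x \<in> space M" for j x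
    using that by (simp add: transport_def the_inv_into_f_f[OF inj])
  have meas: "(\<lambda>(j, y). transport M h T j y) \<in> borel \<Otimes>\<^sub>M ?N \<rightarrow>\<^sub>M ?N"
  proof -
    have "(\<lambda>z. h ((\<lambda>(j, x). T j x) (fst z, ?h' (snd z)))) \<in> borel \<Otimes>\<^sub>M ?N \<rightarrow>\<^sub>M ?N"
      using measurable_action by measurable
    then show ?thesis by (simp add: transport_def case_prod_beta')
  qed
  then have meas1: "transport M h T j \<in> ?N \<rightarrow>\<^sub>M ?N" for j
    using measurable_Pair2[OF meas, of j] by simp
  show ?thesis
  proof
    show "standard_borel ?N" by (rule standard_borel_embed_measure[OF inj standard])
    show "(\<lambda>(j, y). transport M h T j y) \<in> borel \<Otimes>\<^sub>M ?N \<rightarrow>\<^sub>M ?N" by (rule meas)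
    show "transport M h T 0 y = y" if "y \<in> space ?N" for y
      using that by (auto simp: space_embed_measure tr action_zero)
    show "transport M h T (i + j) y = transport M h T i (transport M h T j y)" if "y \<in> space ?N" for i j y
      using that by (auto simp: space_embed_measure tr action_add T_space)
    show "distr ?N ?N (transport M h T j) = ?N" for j
    proof -
      have "distr ?N ?N (transport M h T j) = distr (distr M ?N h) ?N (transport M h T j)"
        using eq by simp
      also have "\<dots> = distr M ?N (transport M h T j \<circ> h)"
        by (rule distr_distr[OF meas1]) simp
      also have "\<dots> = distr M ?N (h \<circ> T j)"
        by (rule distr_cong) (auto simp: tr)
      also have "\<dots> = distr (distr M M (T j)) ?N h"
        by (rule distr_distr[symmetric]) simp_all
      finally show ?thesis using preserves eq by simp
    qed
  qed
qed

lemma ergodic_action_transport: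
  assumes inj: "inj_on h (space M)" and erg: "ergodic_action M T"
  shows "ergodic_action (embed_measure M h) (transport M h T)"
  unfolding ergodic_action_def
proof (intro ballI impI)
  let ?N = "embed_measure M h"
  fix A assume A: "A \<in> sets ?N" "\<forall>j. transport M h T j -` A \<inter> space ?N = A"
  define B where "B = h -` A \<inter> space M"
  have B: "B \<in> sets M"
    unfolding B_def using measurable_embed_measure2'[OF inj] A(1) by (rule measurable_sets)
  have "T j -` B \<inter> space M = B" for j
  proof -
    have "x \<in> T j -` B \<inter> space M \<longleftrightarrow> x \<in> B" for x
    proof (cases "x \<in> space M")
      case True
      have "h x \<in> transport M h T j -` A \<inter> space ?N \<longleftrightarrow> h x \<in> A" using A(2) by simp
      then show ?thesis
        using True T_space[OF True, of j]
        by (simp add: B_def transport_def the_inv_into_f_f[OF inj] space_embed_measure)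
    qed (simp add: B_def)
    then show ?thesis by blast
  qed
  then have "measure M B = 0 \<or> measure M B = 1"
    using erg B unfolding ergodic_action_def by blast
  then show "measure ?N A = 0 \<or> measure ?N A = 1"
    using emeasure_embed_measure'[OF inj A(1)] by (simp add: B_def measure_def)
qed

text \<open>\<open>pointwise_ergodic\<close> speaks of systems on sets of reals only. It is applied
  to the copy of the system under an injection \<open>h\<close>, and orbit averages at
  \<open>h x\<close> in the copy agree with those at \<open>x\<close>.\<close>

lemma AE_generic_point_complex:
  fixes f :: "'x \<Rightarrow> complex"
  assumes pe: "pointwise_ergodic \<nu> F" and erg: "ergodic_action M T" and f: "integrable M f"
  shows "AE x in M. generic_point \<nu> F M T f x"
proof -
  obtain h :: "'x \<Rightarrow> real" where inj: "inj_on h (space M)"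
    using standard_borel_inj_real[OF standard] by blast
  let ?h' = "the_inv_into (space M) h" and ?N = "embed_measure M h"
  define f' where "f' y = f (?h' y)" for y
  have f'_h: "f' (h x) = f x" if "x \<in> space M" for x
    using that by (simp add: f'_def the_inv_into_f_f[OF inj])
  have [measurable]: "f' \<in> borel_measurable ?N"
    unfolding f'_def using measurable_the_inv_into_embed[OF inj] borel_measurable_integrable[OF f]
    by measurable
  have "integrable ?N f'"
    using f by (simp add: integral_embed_measure[OF inj] f'_h cong: Bochner_Integration.integrable_cong)
  then have "AE y in ?N. generic_point \<nu> F ?N (transport M h T) f' y"
    using pe G_MPS_transport[OF inj] ergodic_action_transport[OF inj erg]
    unfolding pointwise_ergodic_def by blast
  then have "AE x in M. generic_point \<nu> F ?N (transport M h T) f' (h x)"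
    by (rule AE_embed_measureD[OF inj])
  then show ?thesis
  proof (rule AE_mp, intro AE_I2 impI)
    fix x assume x: "x \<in> space M" and g: "generic_point \<nu> F ?N (transport M h T) f' (h x)"
    have "f' (transport M h T j (h x)) = f (T j x)" for j
      using x by (simp add: transport_def the_inv_into_f_f[OF inj] f'_h T_space)
    moreover have "(LINT y|?N. f' y) = (LINT x|M. f x)"
      by (simp add: integral_embed_measure[OF inj] f'_h cong: Bochner_Integration.integral_cong)
    ultimately show "generic_point \<nu> F M T f x"
      using g unfolding generic_point_def by simp
  qed
qed

text \<open>Needed because the squares whose genericity matters are real-valued, while the ergodic
  hypothesis concerns complex functions.\<close>

lemma AE_generic_point_real:
  fixes f :: "'x \<Rightarrow> real"
  assumes pe: "pointwise_ergodic \<nu> F" and erg: "ergodic_action M T" and f: "integrable M f"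
  shows "AE x in M. generic_point \<nu> F M T f x"
proof -
  have "AE x in M. generic_point \<nu> F M T (\<lambda>x. complex_of_real (f x)) x"
    by (rule AE_generic_point_complex[OF pe erg]) (use f in simp)
  then show ?thesis
  proof eventually_elim
    case (elim x)
    have si: "set_integrable \<nu> (F n) (\<lambda>j. f (T j x))" for n
    proof -
      have "integrable \<nu> (\<lambda>j. Re (indicator (F n) j *\<^sub>R complex_of_real (f (T j x))))"
        using elim unfolding generic_point_def set_integrable_def by (intro integrable_Re) blast
      then show ?thesis unfolding set_integrable_def by simp
    qed
    have "(LINT j:F n|\<nu>. complex_of_real (f (T j x))) = complex_of_real (LINT j:F n|\<nu>. f (T j x))" for n
      by (rule set_integral_complex_of_real)
    then have "(\<lambda>n. complex_of_real ((1 / measure \<nu> (F n)) *\<^sub>R (LINT j:F n|\<nu>. f (T j x))))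
        \<longlonglongrightarrow> complex_of_real (LINT x|M. f x)"
      using elim unfolding generic_point_def by (simp add: scaleR_conv_of_real)
    then show ?case using si unfolding generic_point_def tendsto_of_real_iff by blast
  qed
qed

end

section \<open>Orbit averages and return times\<close>

lemma (in G_MPS) integrable_comp_T:
  fixes f :: "'x \<Rightarrow> 'b::{banach, second_countable_topology}"
  shows "integrable M f \<Longrightarrow> integrable M (\<lambda>x. f (T j x))"
  using integrable_distr[OF measurable_T, of j f] preserves by simp

lemma (in G_MPS) integral_comp_T:
  fixes f :: "'x \<Rightarrow> 'b::{banach, second_countable_topology}"
  shows "f \<in> borel_measurable M \<Longrightarrow> (LINT x|M. f (T j x)) = (LINT x|M. f x)"
  using integral_distr[OF measurable_T, of f j] preserves by simp

lemma (in G_MPS) L2_fun_comp_T: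
  assumes "f \<in> L2_fun M" shows "f \<circ> T j \<in> L2_fun M"
  using assms integrable_comp_T[of "\<lambda>x. (cmod (f x))\<^sup>2" j] measurable_comp[OF measurable_T, of f borel j]
  by (simp add: L2_fun_def)

lemma (in G_MPS) L2_gap_comp_T:
  assumes "f \<in> borel_measurable M" "g \<in> borel_measurable M"
  shows "L2_gap M (f \<circ> T j) (g \<circ> T j) = L2_gap M f g"
  unfolding L2_gap_def using integral_comp_T[of "\<lambda>x. (cmod (f x - g x))\<^sup>2" j] assms by simp

text \<open>Composition with the measure-preserving map \<open>T k\<close> is an isometry, so
  translating both indices together leaves distances unchanged.\<close>

lemma (in G_MPS) L2_gap_translate:
  assumes [measurable]: "f \<in> borel_measurable M" "g \<in> borel_measurable M"
  shows "L2_gap M (f \<circ> T (i + k)) (g \<circ> T (j + k)) = L2_gap M (f \<circ> T i) (g \<circ> T j)"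
proof -
  have "L2_gap M (f \<circ> T (i + k)) (g \<circ> T (j + k)) = L2_gap M ((f \<circ> T i) \<circ> T k) ((g \<circ> T j) \<circ> T k)"
    unfolding L2_gap_def by (simp add: action_add cong: Bochner_Integration.integral_cong)
  also have "\<dots> = L2_gap M (f \<circ> T i) (g \<circ> T j)"
    by (rule L2_gap_comp_T) (auto intro: measurable_comp[OF measurable_T])
  finally show ?thesis .
qed

lemma (in G_MPS) AE_comp_T:
  assumes "AE x in M. P x" shows "AE x in M. P (T j x)"
  by (rule AE_distrD[OF measurable_T]) (subst preserves, rule assms)

lemma (in G_MPS) measurable_action_comp:
  assumes "f \<in> M \<rightarrow>\<^sub>M N" shows "(\<lambda>(j, x). f (T j x)) \<in> borel \<Otimes>\<^sub>M M \<rightarrow>\<^sub>M N"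
  using measurable_compose[OF measurable_action assms] by (simp add: case_prod_beta')

section \<open>Folner averages as expectations and genericity as convergence of distances\<close>

locale folner_system = G_MPS M T
  for M :: "'x measure" and T :: "'g::{topological_ab_group_add, t2_space} \<Rightarrow> 'x \<Rightarrow> 'x" +
  fixes \<nu> :: "'g measure" and F :: "nat \<Rightarrow> 'g set"
  assumes haar: "haar_measure \<nu>"
    and folner: "folner_sequence \<nu> F"
    and pointwise: "pointwise_ergodic \<nu> F"
    and ergodic: "ergodic_action M T"
begin

text \<open>Normalised Haar measure on \<open>F n\<close>. Orbit averages become expectations, and
  the L2 estimates for probability spaces apply along orbits.\<close>

definition P :: "nat \<Rightarrow> 'g measure" where
  "P n = uniform_measure \<nu> (F n)"

lemma sets_nu [simp, measurable_cong]: "sets \<nu> = sets borel"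
  using haar by (simp add: haar_measure_def)

lemma space_nu [simp]: "space \<nu> = UNIV"
  using sets_eq_imp_space_eq[OF sets_nu] by simp

lemma F_measurable [measurable]: "F n \<in> sets borel"
  using folner by (simp add: folner_sequence_def)

lemma emeasure_F: "0 < emeasure \<nu> (F n)" "emeasure \<nu> (F n) < \<infinity>"
  using folner by (auto simp: folner_sequence_def)

lemma measure_F_pos: "0 < measure \<nu> (F n)"
  using emeasure_F[of n] by (simp add: measure_def enn2real_positive_iff top.not_eq_extremum)

lemma sets_P [simp, measurable_cong]: "sets (P n) = sets borel"
  by (simp add: P_def)

lemma space_P [simp]: "space (P n) = UNIV"
  by (simp add: P_def)

sublocale P: prob_space "P n" for n
  unfolding P_def using emeasure_F[of n] by (intro prob_space_uniform_measure) auto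

lemma P_eq_density: "P n = density \<nu> (\<lambda>j. ennreal (indicator (F n) j / measure \<nu> (F n)))"
proof -
  have "emeasure \<nu> (F n) = ennreal (measure \<nu> (F n))"
    using emeasure_F[of n] by (intro emeasure_eq_ennreal_measure) auto
  then show ?thesis
    unfolding P_def uniform_measure_def
    using measure_F_pos[of n]
    by (intro density_cong) (auto intro!: AE_I2 simp: divide_ennreal indicator_def ennreal_1[symmetric] simp del: ennreal_1)
qed

lemma integrable_P_iff:
  fixes \<phi> :: "'g \<Rightarrow> 'b::{banach, second_countable_topology}"
  assumes [measurable]: "\<phi> \<in> borel_measurable borel"
  shows "integrable (P n) \<phi> \<longleftrightarrow> set_integrable \<nu> (F n) \<phi>"
proof -
  have "integrable (P n) \<phi> \<longleftrightarrow> integrable \<nu> (\<lambda>j. (1 / measure \<nu> (F n)) *\<^sub>R (indicator (F n) j *\<^sub>R \<phi> j))"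
    unfolding P_eq_density by (subst integrable_density) (auto simp: divide_inverse mult.commute)
  also have "\<dots> \<longleftrightarrow> integrable \<nu> (\<lambda>j. indicator (F n) j *\<^sub>R \<phi> j)" (is "integrable \<nu> (\<lambda>j. ?c *\<^sub>R ?g j) \<longleftrightarrow> _")
  proof
    assume "integrable \<nu> (\<lambda>j. ?c *\<^sub>R ?g j)"
    then have "integrable \<nu> (\<lambda>j. measure \<nu> (F n) *\<^sub>R ?c *\<^sub>R ?g j)" by (rule integrable_scaleR_right)
    then show "integrable \<nu> ?g" using measure_F_pos[of n] by simp
  qed (rule integrable_scaleR_right)
  finally show ?thesis unfolding set_integrable_def .
qed

lemma integral_P:
  fixes \<phi> :: "'g \<Rightarrow> 'b::{banach, second_countable_topology}"
  assumes [measurable]: "\<phi> \<in> borel_measurable borel"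
  shows "(LINT j|P n. \<phi> j) = (1 / measure \<nu> (F n)) *\<^sub>R (LINT j:F n|\<nu>. \<phi> j)"
proof -
  have "(LINT j|P n. \<phi> j) = (LINT j|\<nu>. (1 / measure \<nu> (F n)) *\<^sub>R (indicator (F n) j *\<^sub>R \<phi> j))"
    unfolding P_eq_density by (subst integral_density) (auto simp: divide_inverse mult.commute)
  then show ?thesis unfolding set_lebesgue_integral_def by (simp only: integral_scaleR_right)
qed

lemma borel_measurable_orbit:
  assumes "f \<in> borel_measurable M" "x \<in> space M"
  shows "(\<lambda>j. f (T j x)) \<in> borel_measurable borel"
  using measurable_compose[OF measurable_orbit[OF assms(2)] assms(1)] .

lemma generic_point_iff:
  fixes f :: "'x \<Rightarrow> 'b::{banach, second_countable_topology}"
  assumes "f \<in> borel_measurable M" "x \<in> space M"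
  shows "generic_point \<nu> F M T f x \<longleftrightarrow>
    (\<forall>n. integrable (P n) (\<lambda>j. f (T j x))) \<and> (\<lambda>n. LINT j|P n. f (T j x)) \<longlonglongrightarrow> (LINT x|M. f x)"
  unfolding generic_point_def
  using borel_measurable_orbit[OF assms] by (simp add: integrable_P_iff integral_P)

lemma d_mean_eq:
  assumes [measurable]: "f \<in> borel_measurable M" and x: "x \<in> space M" and y: "y \<in> space M"
  shows "d_mean \<nu> F T f x y = limsup (\<lambda>n. ereal (L2_gap (P n) (\<lambda>j. f (T j x)) (\<lambda>j. f (T j y))))"
proof -
  have [measurable]: "(\<lambda>j. f (T j x)) \<in> borel_measurable borel" "(\<lambda>j. f (T j y)) \<in> borel_measurable borel"
    using x y by (auto intro: borel_measurable_orbit)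
  show ?thesis unfolding d_mean_def L2_gap_def by (simp add: integral_P)
qed

lemma L2_fun_orbit:
  assumes f: "f \<in> L2_fun M" and x: "x \<in> space M" and g: "generic_point \<nu> F M T (\<lambda>z. (cmod (f z))\<^sup>2) x"
  shows "(\<lambda>j. f (T j x)) \<in> L2_fun (P n)"
proof -
  have [measurable]: "f \<in> borel_measurable M" using f by (rule L2_fun_measurable)
  show ?thesis
    using g borel_measurable_orbit[OF _ x, of f] unfolding L2_fun_def
    by (subst (asm) generic_point_iff[OF _ x]) (auto simp: measurable_cong_sets[OF sets_P refl])
qed

lemma AE_generic_diff:
  assumes "f \<in> L2_fun M" "g \<in> L2_fun M"
  shows "AE x in M. generic_point \<nu> F M T (\<lambda>z. (cmod (f z - g z))\<^sup>2) x"
  by (rule AE_generic_point_real[OF pointwise ergodic L2_fun_diff_integrable[OF assms]])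

lemma AE_generic_norm2:
  assumes "f \<in> L2_fun M"
  shows "AE x in M. generic_point \<nu> F M T (\<lambda>z. (cmod (f z))\<^sup>2) x"
  by (rule AE_generic_point_real[OF pointwise ergodic]) (use assms in \<open>simp add: L2_fun_def\<close>)

text \<open>The bridge from single orbits to the space: genericity for the squared difference
  equates the limiting time average with the squared L2 distance, and the square root is
  continuous.\<close>

lemma generic_diff_tendsto_gap:
  assumes "f \<in> L2_fun M" "g \<in> L2_fun M" "x \<in> space M"
    and "generic_point \<nu> F M T (\<lambda>z. (cmod (f z - g z))\<^sup>2) x"
  shows "(\<lambda>n. L2_gap (P n) (\<lambda>j. f (T j x)) (\<lambda>j. g (T j x))) \<longlonglongrightarrow> L2_gap M f g"
proof -
  have "(\<lambda>z. (cmod (f z - g z))\<^sup>2) \<in> borel_measurable M"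
    using assms(1,2) by (auto simp: L2_fun_def)
  then show ?thesis
    unfolding L2_gap_def using assms(4) by (intro tendsto_real_sqrt) (simp add: generic_point_iff assms(3))
qed

lemma AE_ex_mem:
  assumes "A \<in> sets M" "0 < measure M A" "AE x in M. Q x"
  obtains x where "x \<in> A" "Q x"
proof -
  have "\<not> (AE x in M. x \<notin> A)"
    using assms(1,2) AE_iff_null_sets[OF assms(1)] by (auto simp: null_sets_def measure_def)
  moreover have "AE x in M. x \<notin> A" if "\<And>x. x \<in> A \<Longrightarrow> \<not> Q x"
    using assms(3) by eventually_elim (use that in blast)
  ultimately show ?thesis using that by blast
qed

text \<open>At almost every point of \<open>A \<inter> T\<^sup>-\<^sup>j A\<close> the orbit averages compute the distance of \<open>f\<close> and \<open>f \<circ> T\<^sup>j\<close>.\<close>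

lemma L2_gap_return_le:
  assumes f: "f \<in> L2_fun M" and A: "A \<in> sets M" "0 < measure M (A \<inter> (T j -` A \<inter> space M))"
    and d: "\<And>x y. x \<in> A \<Longrightarrow> y \<in> A \<Longrightarrow> generic_point \<nu> F M T (\<lambda>z. (cmod (f z))\<^sup>2) x \<Longrightarrow>
      generic_point \<nu> F M T (\<lambda>z. (cmod (f z))\<^sup>2) y \<Longrightarrow> d_mean \<nu> F T f x y \<le> ereal \<epsilon>"
  shows "L2_gap M f (f \<circ> T j) \<le> \<epsilon>"
proof -
  note fT = L2_fun_comp_T[OF f, of j]
  have [measurable]: "f \<in> borel_measurable M" using f by (rule L2_fun_measurable)
  have AE: "AE x in M. generic_point \<nu> F M T (\<lambda>z. (cmod (f z))\<^sup>2) x \<and>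
      generic_point \<nu> F M T (\<lambda>z. (cmod (f z))\<^sup>2) (T j x) \<and>
      generic_point \<nu> F M T (\<lambda>z. (cmod (f z - (f \<circ> T j) z))\<^sup>2) x"
    using AE_generic_norm2[OF f] AE_comp_T[OF AE_generic_norm2[OF f], of j] AE_generic_diff[OF f fT]
    by auto
  have S: "A \<inter> (T j -` A \<inter> space M) \<in> sets M"
    using A(1) measurable_sets[OF measurable_T A(1)] by blast
  obtain x where x: "x \<in> A \<inter> (T j -` A \<inter> space M)"
      "generic_point \<nu> F M T (\<lambda>z. (cmod (f z))\<^sup>2) x"
      "generic_point \<nu> F M T (\<lambda>z. (cmod (f z))\<^sup>2) (T j x)"
      "generic_point \<nu> F M T (\<lambda>z. (cmod (f z - (f \<circ> T j) z))\<^sup>2) x"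
    using AE_ex_mem[OF S A(2) AE] by blast
  then have xs: "x \<in> space M" "T j x \<in> space M" by (auto intro: T_space)
  \<comment> \<open>Commutativity of the group: moving the base point from \<open>x\<close> to
    \<open>T j x\<close> has the same effect on the orbit as replacing \<open>f\<close> by
    \<open>f \<circ> T j\<close> at the base point \<open>x\<close>.\<close>
  have comm: "T i (T j x) = T j (T i x)" for i
    using action_add[OF xs(1), of i j] action_add[OF xs(1), of j i] by (simp add: add.commute)
  have "(\<lambda>n. L2_gap (P n) (\<lambda>i. f (T i x)) (\<lambda>i. f (T i (T j x)))) \<longlonglongrightarrow> L2_gap M f (f \<circ> T j)"
    using generic_diff_tendsto_gap[OF f fT xs(1) x(4)] by (simp add: comm o_def)
  then have "d_mean \<nu> F T f x (T j x) = ereal (L2_gap M f (f \<circ> T j))"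
    unfolding d_mean_eq[OF \<open>f \<in> borel_measurable M\<close> xs]
    by (intro lim_imp_Limsup) auto
  moreover have "d_mean \<nu> F T f x (T j x) \<le> ereal \<epsilon>" using x by (intro d) auto
  ultimately show ?thesis by simp
qed

text \<open>Almost every point lies in at most one of the sets, so the sum of their indicators is at
  most 1 almost everywhere; its integral is the left side.\<close>

lemma card_AE_disjoint_le:
  assumes K: "finite K" and B: "\<And>k. k \<in> K \<Longrightarrow> B k \<in> sets M \<and> measure M (B k) = a"
    and null: "\<And>i k. i \<in> K \<Longrightarrow> k \<in> K \<Longrightarrow> i \<noteq> k \<Longrightarrow> measure M (B i \<inter> B k) = 0"
  shows "real (card K) * a \<le> 1"
proof -
  have "AE x in M. \<forall>i\<in>K. \<forall>k\<in>K. i \<noteq> k \<longrightarrow> \<not> (x \<in> B i \<and> x \<in> B k)"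
  proof (intro AE_finite_allI[OF K])
    fix i k assume ik: "i \<in> K" "k \<in> K"
    show "AE x in M. i \<noteq> k \<longrightarrow> \<not> (x \<in> B i \<and> x \<in> B k)"
    proof (cases "i = k")
      case False
      have "B i \<inter> B k \<in> null_sets M"
        using null[OF ik False] B ik by (auto simp: null_sets_def emeasure_eq_measure)
      from AE_not_in[OF this] show ?thesis by eventually_elim auto
    qed simp
  qed
  then have le: "AE x in M. (\<Sum>k\<in>K. indicator (B k) x) \<le> (1::real)"
  proof eventually_elim
    case (elim x)
    show ?case
    proof (cases "\<exists>i\<in>K. x \<in> B i")
      case True
      then obtain i where i: "i \<in> K" "x \<in> B i" by blast
      have "(\<Sum>k\<in>K. indicator (B k) x) = (\<Sum>k\<in>K. if k = i then 1 else (0::real))"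
        by (rule sum.cong) (use elim i in auto)
      then show ?thesis using K i by simp
    next
      case False
      then have "(\<Sum>k\<in>K. indicator (B k) x) = (0::real)" by (intro sum.neutral) auto
      then show ?thesis by simp
    qed
  qed
  have "real (card K) * a = (\<Sum>k\<in>K. LINT x|M. indicator (B k) x)"
    using B by (simp add: Int_absorb2 sets.sets_into_space cong: sum.cong)
  also have "\<dots> = (LINT x|M. (\<Sum>k\<in>K. indicator (B k) x))"
    using B by (subst Bochner_Integration.integral_sum) (auto simp: emeasure_eq_measure)
  also have "\<dots> \<le> (LINT x|M. 1)"
    by (rule integral_mono_AE[OF _ _ le]) (use B in \<open>auto simp: emeasure_eq_measure\<close>)
  finally show ?thesis by (simp add: prob_space)
qed

text \<open>
  Translates \<open>T\<^sup>-\<^sup>k A\<close> with pairwise null intersections number at most \<open>1 / \<mu>(A)\<close>; a maximal such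
  family yields a finite net of the orbit.
\<close>

lemma almost_periodic_if_not_mean_sensitive:
  assumes f: "f \<in> L2_fun M" and not_ms: "\<not> mean_sensitive \<nu> F M T f"
  shows "almost_periodic M T f"
  unfolding almost_periodic_iff[of f T, OF L2_fun_comp_T[OF f]]
proof (intro allI impI)
  fix e :: real assume e: "0 < e"
  have fm: "f \<in> borel_measurable M" using f by (rule L2_fun_measurable)
  \<comment> \<open>Sensitivity is refuted at \<open>e/2\<close> because the resulting bound is not
    strict, whereas the net requires strict inequality with \<open>e\<close>.\<close>
  have "\<not> (\<forall>A\<in>sets M. measure M A > 0 \<longrightarrow>
        (\<exists>x\<in>A. \<exists>y\<in>A. generic_point \<nu> F M T (\<lambda>z. (cmod (f z))\<^sup>2) x \<and>
           generic_point \<nu> F M T (\<lambda>z. (cmod (f z))\<^sup>2) y \<and> d_mean \<nu> F T f x y > ereal (e/2)))"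
    using not_ms e unfolding mean_sensitive_def by (meson half_gt_zero)
  then obtain A where A: "A \<in> sets M" "0 < measure M A"
    and d: "\<And>x y. x \<in> A \<Longrightarrow> y \<in> A \<Longrightarrow> generic_point \<nu> F M T (\<lambda>z. (cmod (f z))\<^sup>2) x \<Longrightarrow>
      generic_point \<nu> F M T (\<lambda>z. (cmod (f z))\<^sup>2) y \<Longrightarrow> d_mean \<nu> F T f x y \<le> ereal (e/2)"
    by (force simp: not_less)
  define B where "B k = T k -` A \<inter> space M" for k
  have B: "B k \<in> sets M" for k unfolding B_def by (rule measurable_sets[OF measurable_T A(1)])
  have mB: "measure M (T k -` S \<inter> space M) = measure M S" if "S \<in> sets M" for k S
    using measure_distr[OF measurable_T that, of k] preserves by simp
  define fam where "fam K \<longleftrightarrow> finite K \<and> (\<forall>i\<in>K. \<forall>k\<in>K. i \<noteq> k \<longrightarrow> measure M (B i \<inter> B k) = 0)" for K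
  have bound: "card K \<le> nat \<lceil>1 / measure M A\<rceil>" if "fam K" for K
  proof -
    have "real (card K) * measure M A \<le> 1"
      by (rule card_AE_disjoint_le[of K B]) (use that B mB[OF A(1)] in \<open>auto simp: fam_def B_def\<close>)
    then have "real (card K) \<le> 1 / measure M A" using A(2) by (simp add: pos_le_divide_eq)
    then show ?thesis by linarith
  qed
  obtain K where K: "fam K" "\<And>K'. fam K' \<Longrightarrow> card K' \<le> card K"
  proof -
    have "fam {}" by (simp add: fam_def)
    then obtain K where "fam K" "\<forall>K'. fam K' \<longrightarrow> card K' \<le> card K"
      using ex_has_greatest_nat[of fam "{}" card "Suc (nat \<lceil>1 / measure M A\<rceil>)"] bound
      by (auto simp: less_Suc_eq_le)
    then show ?thesis by (intro that[of K]) blast+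
  qed
  have "\<exists>k\<in>K. L2_gap M (f \<circ> T k) (f \<circ> T j) < e" for j
  proof (cases "j \<in> K")
    case True
    then show ?thesis using e by (intro bexI[of _ j]) auto
  next
    case False
    have "finite K" using K(1) by (simp add: fam_def)
    then have "card (insert j K) > card K" using False by simp
    \<comment> \<open>By maximality, the translate belonging to \<open>j\<close> must meet some
      \<open>B k\<close> in positive measure.\<close>
    then have "\<not> fam (insert j K)" using K(2) by (metis not_less)
    then obtain k where k: "k \<in> K" "measure M (B k \<inter> B j) \<noteq> 0"
      using K(1) unfolding fam_def by (auto simp: Int_commute)
    \<comment> \<open>The intersection is the \<open>T k\<close>-preimage of the points of
      \<open>A\<close> that return to \<open>A\<close> under \<open>T (j - k)\<close>, so
      \<open>j - k\<close> is a return time of positive measure.\<close>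
    have "B k \<inter> B j = T k -` (A \<inter> (T (j - k) -` A \<inter> space M)) \<inter> space M"
      using action_add[of _ "j - k" k] by (auto simp: B_def T_space)
    moreover have "A \<inter> (T (j - k) -` A \<inter> space M) \<in> sets M"
      using A(1) measurable_sets[OF measurable_T A(1)] by blast
    ultimately have "0 < measure M (A \<inter> (T (j - k) -` A \<inter> space M))"
      using mB k(2) by (metis measure_nonneg less_le)
    then have "L2_gap M f (f \<circ> T (j - k)) \<le> e/2"
      by (rule L2_gap_return_le[OF f A(1) _ d])
    moreover have "L2_gap M (f \<circ> T k) (f \<circ> T j) = L2_gap M (f \<circ> T 0) (f \<circ> T (j - k))"
      using L2_gap_translate[OF fm fm, of 0 k "j - k"] by simp
    moreover have "\<dots> = L2_gap M f (f \<circ> T (j - k))"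
      unfolding L2_gap_def by (simp add: action_zero cong: Bochner_Integration.integral_cong)
    ultimately show ?thesis using e k(1) by (intro bexI[of _ k]) auto
  qed
  then show "\<exists>K. finite K \<and> (\<forall>j. \<exists>k\<in>K. L2_gap M (f \<circ> T k) (f \<circ> T j) < e)"
    using K(1) by (auto simp: fam_def)
qed

end

section \<open>Averages of orbits\<close>

lemma (in prob_space) integral_norm_le_const:
  fixes h :: "'a \<Rightarrow> 'b::{banach, second_countable_topology}"
  assumes "\<And>x. x \<in> space M \<Longrightarrow> norm (h x) \<le> C" "0 \<le> C"
  shows "norm (LINT x|M. h x) \<le> C"
proof (cases "integrable M h")
  case True
  have "norm (LINT x|M. h x) \<le> (LINT x|M. norm (h x))" by (rule integral_norm_bound)
  also have "\<dots> \<le> (LINT x|M. C)" by (intro integral_mono integrable_norm True assms) auto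
  finally show ?thesis by (simp add: prob_space)
qed (use assms(2) in \<open>simp add: not_integrable_integral_eq\<close>)

lemma (in prob_space) integral_norm_power2_le:
  fixes h :: "'a \<Rightarrow> complex"
  assumes [measurable]: "h \<in> borel_measurable M" and h: "\<And>x. x \<in> space M \<Longrightarrow> cmod (h x) \<le> C"
  shows "(cmod (LINT x|M. h x))\<^sup>2 \<le> (LINT x|M. (cmod (h x))\<^sup>2)"
proof -
  have "h \<in> L2_fun M" "(\<lambda>_. 0) \<in> L2_fun M"
    using L2_fun_bounded[OF finite_measure_axioms, of h C] h by (auto simp: L2_fun_def)
  then have "(LINT x|M. cmod (h x)) \<le> L2_gap M h (\<lambda>_. 0)"
    using L1_le_L2_gap(1)[of h "\<lambda>_. 0"] by simp
  moreover have "cmod (LINT x|M. h x) \<le> (LINT x|M. cmod (h x))" by (rule integral_norm_bound)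
  ultimately have "(cmod (LINT x|M. h x))\<^sup>2 \<le> (L2_gap M h (\<lambda>_. 0))\<^sup>2"
    by (intro power_mono norm_ge_zero) (rule order_trans)
  then show ?thesis by (simp add: L2_gap_power2)
qed

text \<open>For fixed \<open>x\<close>, Jensen's inequality bounds the squared modulus of the
  averaged difference by the average of the squares. Fubini then leaves the average over
  \<open>j\<close> of squared distances. The bound is asked only for almost every \<open>j\<close>,
  since the weighted averages below ignore the \<open>j\<close> of weight 0.\<close>

lemma L2_gap_average_le:
  fixes u v :: "'g \<Rightarrow> 'x \<Rightarrow> complex"
  assumes "prob_space Q" "prob_space M"
    and u: "(\<lambda>(j, x). u j x) \<in> borel_measurable (Q \<Otimes>\<^sub>M M)" "\<And>j x. cmod (u j x) \<le> C"
    and v: "(\<lambda>(j, x). v j x) \<in> borel_measurable (Q \<Otimes>\<^sub>M M)" "\<And>j x. cmod (v j x) \<le> C"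
    and gap: "AE j in Q. L2_gap M (u j) (v j) \<le> \<delta>" and "0 \<le> \<delta>"
  shows "L2_gap M (\<lambda>x. LINT j|Q. u j x) (\<lambda>x. LINT j|Q. v j x) \<le> \<delta>"
proof -
  interpret Q: prob_space Q by fact
  interpret M: prob_space M by fact
  interpret QM: pair_prob_space Q M ..
  have [measurable]: "(\<lambda>z. u (fst z) (snd z)) \<in> borel_measurable (Q \<Otimes>\<^sub>M M)"
      "(\<lambda>z. v (fst z) (snd z)) \<in> borel_measurable (Q \<Otimes>\<^sub>M M)"
    using u v by (simp_all add: case_prod_beta')
  have [measurable]: "(\<lambda>z. u (snd z) (fst z)) \<in> borel_measurable (M \<Otimes>\<^sub>M Q)"
      "(\<lambda>z. v (snd z) (fst z)) \<in> borel_measurable (M \<Otimes>\<^sub>M Q)"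
    using measurable_compose[OF measurable_pair_swap' u(1)] measurable_compose[OF measurable_pair_swap' v(1)]
    by (simp_all add: case_prod_beta')
  have slice: "(\<lambda>j. u j x) \<in> borel_measurable Q" "(\<lambda>j. v j x) \<in> borel_measurable Q"
    if "x \<in> space M" for x
    using measurable_Pair1[OF u(1) that] measurable_Pair1[OF v(1) that] by simp_all
  have slice': "u j \<in> borel_measurable M" "v j \<in> borel_measurable M"
    if "j \<in> space Q" for j
    using measurable_Pair2[OF u(1) that] measurable_Pair2[OF v(1) that] by simp_all
  have C: "cmod (u j x - v j x) \<le> 2 * C" for j x
    using norm_triangle_ineq4[of "u j x" "v j x"] u(2)[of j x] v(2)[of j x] by linarith
  have C0: "0 \<le> C" using u(2) norm_ge_zero order_trans by blast
  have C2: "(cmod (u j x - v j x))\<^sup>2 \<le> (2 * C)\<^sup>2" for j x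
    using C by (intro power_mono) auto
  have int: "integrable (Q \<Otimes>\<^sub>M M) (\<lambda>(j, x). (cmod (u j x - v j x))\<^sup>2)"
    by (rule QM.integrable_const_bound[where B="(2 * C)\<^sup>2"])
       (use C2 in \<open>auto simp: case_prod_beta'\<close>)
  have "(LINT x|M. (cmod ((LINT j|Q. u j x) - (LINT j|Q. v j x)))\<^sup>2)
      \<le> (LINT x|M. LINT j|Q. (cmod (u j x - v j x))\<^sup>2)"
  proof (rule integral_mono)
    fix x assume x: "x \<in> space M"
    have "integrable Q (\<lambda>j. u j x)" "integrable Q (\<lambda>j. v j x)"
      using Q.integrable_const_bound[of "\<lambda>j. u j x" C] Q.integrable_const_bound[of "\<lambda>j. v j x" C]
        slice[OF x] u(2) v(2) by auto
    then have "(LINT j|Q. u j x) - (LINT j|Q. v j x) = (LINT j|Q. u j x - v j x)" by simp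
    then show "(cmod ((LINT j|Q. u j x) - (LINT j|Q. v j x)))\<^sup>2 \<le> (LINT j|Q. (cmod (u j x - v j x))\<^sup>2)"
      using Q.integral_norm_power2_le[of "\<lambda>j. u j x - v j x" "2 * C"] slice[OF x] C by simp
  next
    show "integrable M (\<lambda>x. LINT j|Q. (cmod (u j x - v j x))\<^sup>2)"
      using QM.integrable_snd[OF int] by simp
    show "integrable M (\<lambda>x. (cmod ((LINT j|Q. u j x) - (LINT j|Q. v j x)))\<^sup>2)"
    proof (rule M.integrable_const_bound[where B="(2 * C)\<^sup>2"])
      show "AE x in M. norm ((cmod ((LINT j|Q. u j x) - (LINT j|Q. v j x)))\<^sup>2) \<le> (2 * C)\<^sup>2"
      proof (intro AE_I2)
        fix x
        have "cmod (LINT j|Q. u j x) \<le> C" "cmod (LINT j|Q. v j x) \<le> C"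
          by (rule Q.integral_norm_le_const; use u v C0 in auto)+
        then have "cmod ((LINT j|Q. u j x) - (LINT j|Q. v j x)) \<le> 2 * C"
          using norm_triangle_ineq4[of "LINT j|Q. u j x" "LINT j|Q. v j x"] by linarith
        then have "(cmod ((LINT j|Q. u j x) - (LINT j|Q. v j x)))\<^sup>2 \<le> (2 * C)\<^sup>2"
          by (intro power_mono norm_ge_zero)
        then show "norm ((cmod ((LINT j|Q. u j x) - (LINT j|Q. v j x)))\<^sup>2) \<le> (2 * C)\<^sup>2"
          by (simp only: real_norm_def abs_power2)
      qed
    qed measurable
  qed
  also have "\<dots> = (LINT j|Q. LINT x|M. (cmod (u j x - v j x))\<^sup>2)"
    by (rule QM.Fubini_integral[OF int])
  also have "\<dots> = (LINT j|Q. (L2_gap M (u j) (v j))\<^sup>2)"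
    by (simp add: L2_gap_power2)
  also have "\<dots> \<le> (LINT j|Q. \<delta>\<^sup>2)"
  proof (rule integral_mono_AE)
    show "integrable Q (\<lambda>j. (L2_gap M (u j) (v j))\<^sup>2)"
      using QM.integrable_fst[OF int] by (simp add: L2_gap_power2)
    show "AE j in Q. (L2_gap M (u j) (v j))\<^sup>2 \<le> \<delta>\<^sup>2"
      using gap by eventually_elim (auto intro: power_mono)
  qed simp
  finally show ?thesis
    unfolding L2_gap_def using \<open>0 \<le> \<delta>\<close> by (intro real_le_lsqrt) (auto simp: Q.prob_space)
qed

section \<open>Asymptotic translation invariance of Folner averages\<close>

context folner_system
begin

lemma translate_image: "(+) k ` S = (+) (- k) -` S" for S :: "'g set"
proof (intro set_eqI iffI)
  fix x assume "x \<in> (+) (- k) -` S"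
  then show "x \<in> (+) k ` S" by (intro image_eqI[of _ _ "- k + x"]) auto
qed auto

lemma translate_measurable [measurable]: "(+) k \<in> borel \<rightarrow>\<^sub>M (borel :: 'g measure)"
  by (intro borel_measurable_continuous_onI continuous_intros)

lemma translate_image_measurable:
  "S \<in> sets borel \<Longrightarrow> (+) k ` S \<in> sets borel" for S :: "'g set"
  unfolding translate_image using measurable_sets[OF translate_measurable, of S "- k"] by simp

lemma emeasure_translate: "A \<in> sets borel \<Longrightarrow> emeasure \<nu> ((+) k ` A) = emeasure \<nu> A"
  using haar by (simp add: haar_measure_def)

lemma distr_translate: "distr \<nu> \<nu> ((+) k) = \<nu>"
proof (rule measure_eqI)
  fix A assume "A \<in> sets (distr \<nu> \<nu> ((+) k))"
  then have A: "A \<in> sets borel" by simp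
  have "(+) k \<in> \<nu> \<rightarrow>\<^sub>M \<nu>"
    using translate_measurable[of k] by (simp cong: measurable_cong_sets)
  then have "emeasure (distr \<nu> \<nu> ((+) k)) A = emeasure \<nu> ((+) k -` A)"
    using A by (simp add: emeasure_distr)
  also have "(+) k -` A = (+) (- k) ` A"
    unfolding translate_image[of "- k" A] by (simp only: minus_minus)
  also have "emeasure \<nu> \<dots> = emeasure \<nu> A" using A by (rule emeasure_translate)
  finally show "emeasure (distr \<nu> \<nu> ((+) k)) A = emeasure \<nu> A" .
qed simp

text \<open>Invariance of \<open>\<nu>\<close> moves the shift from \<open>\<phi>\<close> to the set
  \<open>F n\<close>. The two integrals then differ only on the symmetric difference of
  \<open>F n\<close> and its translate, where \<open>\<phi>\<close> is at most
  \<open>C\<close>.\<close>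

lemma folner_average_translate:
  fixes \<phi> :: "'g \<Rightarrow> 'b::{banach, second_countable_topology}"
  assumes [measurable]: "\<phi> \<in> borel_measurable borel" and C: "\<And>j. norm (\<phi> j) \<le> C"
  shows "(\<lambda>n. (LINT j|P n. \<phi> (j + k)) - (LINT j|P n. \<phi> j)) \<longlonglongrightarrow> 0"
proof (rule Lim_null_comparison)
  let ?S = "\<lambda>n. sym_diff ((+) k ` F n) (F n)"
  have C0: "0 \<le> C" using C norm_ge_zero order_trans by blast
  have kF [measurable]: "(+) k ` F n \<in> sets borel" for n by (rule translate_image_measurable) simp
  have fin: "emeasure \<nu> ((+) k ` F n) < \<infinity>" for n
    using emeasure_F[of n] by (simp add: emeasure_translate)
  have finS: "emeasure \<nu> (?S n) < \<infinity>" for n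
  proof -
    have "emeasure \<nu> (?S n) \<le> emeasure \<nu> ((+) k ` F n \<union> F n)" by (rule emeasure_mono) auto
    also have "\<dots> \<le> emeasure \<nu> ((+) k ` F n) + emeasure \<nu> (F n)" by (rule emeasure_subadditive) auto
    also have "\<dots> < \<infinity>" using fin emeasure_F by (simp add: ennreal_add_less_top)
    finally show ?thesis .
  qed
  have bdd: "integrable \<nu> (\<lambda>j. indicator S j *\<^sub>R \<phi> j)" if "S \<in> sets borel" "emeasure \<nu> S < \<infinity>" for S
    by (rule integrableI_bounded_set[of S _ _ C]) (use that C in \<open>auto intro!: AE_I2 simp: indicator_def\<close>)
  have "norm ((LINT j|P n. \<phi> (j + k)) - (LINT j|P n. \<phi> j)) \<le> C * (measure \<nu> (?S n) / measure \<nu> (F n))" for n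
  proof -
    have "(LINT j:F n|\<nu>. \<phi> (j + k)) = (LINT j|\<nu>. indicator ((+) k ` F n) (k + j) *\<^sub>R \<phi> (k + j))"
      unfolding set_lebesgue_integral_def
      by (intro Bochner_Integration.integral_cong) (auto simp: indicator_def translate_image add.commute)
    also have "\<dots> = (LINT j|distr \<nu> \<nu> ((+) k). indicator ((+) k ` F n) j *\<^sub>R \<phi> j)"
      by (rule integral_distr[symmetric]) (auto cong: measurable_cong_sets)
    also have "\<dots> = (LINT j|\<nu>. indicator ((+) k ` F n) j *\<^sub>R \<phi> j)" by (simp add: distr_translate)
    finally have "(LINT j:F n|\<nu>. \<phi> (j + k)) - (LINT j:F n|\<nu>. \<phi> j)
        = (LINT j|\<nu>. indicator ((+) k ` F n) j *\<^sub>R \<phi> j - indicator (F n) j *\<^sub>R \<phi> j)"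
      unfolding set_lebesgue_integral_def using bdd fin emeasure_F by simp
    also have "norm \<dots> \<le> (LINT j|\<nu>. C * indicator (?S n) j)"
    proof (rule order_trans[OF integral_norm_bound integral_mono])
      show "integrable \<nu> (\<lambda>j. norm (indicator ((+) k ` F n) j *\<^sub>R \<phi> j - indicator (F n) j *\<^sub>R \<phi> j))"
        using bdd fin emeasure_F by (intro integrable_norm Bochner_Integration.integrable_diff) auto
      show "integrable \<nu> (\<lambda>j. C * indicator (?S n) j)"
        using finS by (intro integrable_mult_right integrable_real_indicator) auto
      show "norm (indicator ((+) k ` F n) j *\<^sub>R \<phi> j - indicator (F n) j *\<^sub>R \<phi> j) \<le> C * indicator (?S n) j" for j
        using C[of j] by (auto simp: indicator_def)
    qed
    also have "\<dots> = C * measure \<nu> (?S n)" by simp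
    finally have le: "norm ((LINT j:F n|\<nu>. \<phi> (j + k)) - (LINT j:F n|\<nu>. \<phi> j)) \<le> C * measure \<nu> (?S n)" .
    have [measurable]: "(\<lambda>j. \<phi> (j + k)) \<in> borel_measurable borel"
      using measurable_compose[OF translate_measurable[of k], of \<phi>] by (simp add: add.commute)
    have "(LINT j|P n. \<phi> (j + k)) - (LINT j|P n. \<phi> j)
        = (1 / measure \<nu> (F n)) *\<^sub>R ((LINT j:F n|\<nu>. \<phi> (j + k)) - (LINT j:F n|\<nu>. \<phi> j))"
      by (simp add: integral_P scaleR_diff_right)
    then have "norm ((LINT j|P n. \<phi> (j + k)) - (LINT j|P n. \<phi> j))
        = norm ((LINT j:F n|\<nu>. \<phi> (j + k)) - (LINT j:F n|\<nu>. \<phi> j)) / measure \<nu> (F n)"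
      by simp
    then show ?thesis using le measure_F_pos[of n] by (simp add: divide_right_mono)
  qed
  then show "\<forall>\<^sub>F n in sequentially. norm ((LINT j|P n. \<phi> (j + k)) - (LINT j|P n. \<phi> j))
      \<le> C * (measure \<nu> (?S n) / measure \<nu> (F n))" by simp
  show "(\<lambda>n. C * (measure \<nu> (?S n) / measure \<nu> (F n))) \<longlonglongrightarrow> 0"
    using folner unfolding folner_sequence_def by (intro tendsto_mult_right_zero) blast
qed

end

section \<open>Compactness of families of orbit averages\<close>

context G_MPS
begin

text \<open>A parameter integral of a jointly measurable function. This makes the weights and the
  choice of a close net member measurable on the group.\<close>

lemma measurable_L2_gap_orbit [measurable]:
  assumes [measurable]: "f \<in> borel_measurable M" "g \<in> borel_measurable M"
  shows "(\<lambda>j. L2_gap M (f \<circ> T j) g) \<in> borel_measurable borel"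
proof -
  have [measurable]: "(\<lambda>z. f (T (fst z) (snd z))) \<in> borel_measurable (borel \<Otimes>\<^sub>M M)"
    using measurable_action_comp[of f borel] assms by (simp add: case_prod_beta')
  show ?thesis unfolding L2_gap_def o_def by measurable
qed

text \<open>
  An average of the orbit of \<open>f\<close> is close to a convex combination of the members of a finite net,
  and the coefficients of these combinations range over a totally bounded set.
\<close>

lemma orbit_averages_totally_bounded:
  fixes Q :: "nat \<Rightarrow> 'g measure"
  assumes f: "f \<in> borel_measurable M" "\<And>x. cmod (f x) \<le> B"
    and Q: "\<And>n. prob_space (Q n)" "\<And>n. sets (Q n) = sets borel"
    and net: "\<And>e. 0 < e \<Longrightarrow> \<exists>K. finite K \<and> (\<forall>j. \<exists>k\<in>K. L2_gap M (f \<circ> T k) (f \<circ> T j) < e)"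
    and e: "0 < e"
  shows "\<exists>K. finite K \<and> (\<forall>n. \<exists>k\<in>K.
    L2_gap M (\<lambda>x. LINT j|Q k. f (T j x)) (\<lambda>x. LINT j|Q n. f (T j x)) < e)"
proof -
  note [measurable] = f(1)
  note [measurable_cong] = Q(2)
  have B0: "0 \<le> B" using f(2) norm_ge_zero order_trans by blast
  \<comment> \<open>Three distances of at most \<open>\<delta>\<close> are added at the end: from
    \<open>G k\<close> to \<open>v k\<close>, from there to \<open>v n\<close>, and on to
    \<open>G n\<close>.\<close>
  define \<delta> where "\<delta> = e / 4"
  have \<delta>: "0 < \<delta>" using e by (simp add: \<delta>_def)
  obtain K where K: "finite K" "\<And>j. \<exists>k\<in>K. L2_gap M (f \<circ> T k) (f \<circ> T j) < \<delta>" using net[OF \<delta>] by blast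
  obtain ks where ks: "set ks = K" using finite_list[OF K(1)] by blast
  define m where "m = length ks"
  have ex: "\<exists>i. i < m \<and> L2_gap M (f \<circ> T (ks ! i)) (f \<circ> T j) < \<delta>" for j
    using K(2)[of j] ks by (auto simp: m_def in_set_conv_nth)
  \<comment> \<open>Choosing the least admissible index makes the selection of a net member
    measurable in \<open>j\<close>.\<close>
  define idx where "idx j = (LEAST i. i < m \<and> L2_gap M (f \<circ> T (ks ! i)) (f \<circ> T j) < \<delta>)" for j
  have idx: "idx j < m" "L2_gap M (f \<circ> T (ks ! idx j)) (f \<circ> T j) < \<delta>" for j
    using LeastI_ex[OF ex[of j]] by (simp_all add: idx_def)
  have fT: "f \<circ> T k \<in> borel_measurable M" for k
    using measurable_comp[OF measurable_T f(1)] .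
  have [measurable]: "(\<lambda>j. L2_gap M (f \<circ> T k) (f \<circ> T j)) \<in> borel_measurable borel" for k
    using measurable_L2_gap_orbit[OF f(1) fT] by (simp add: L2_gap_commute)
  have [measurable]: "idx \<in> borel \<rightarrow>\<^sub>M count_space UNIV"
    unfolding idx_def by measurable
  have [measurable]: "(\<lambda>z. f (T (fst z) (snd z))) \<in> borel_measurable (borel \<Otimes>\<^sub>M M)"
    using measurable_action_comp[of f borel] f(1) by (simp add: case_prod_beta')
  \<comment> \<open>The coefficients \<open>p n i\<close> are the \<open>Q n\<close> masses of the
    group elements assigned to the \<open>i\<close>-th net member; \<open>v n\<close> is the
    resulting convex combination.\<close>
  define p where "p n i = measure (Q n) {j. idx j = i}" for n i
  define v where "v n x = (\<Sum>i<m. p n i *\<^sub>R f (T (ks ! i) x))" for n x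
  define G where "G n x = (LINT j|Q n. f (T j x))" for n x
  have p01: "0 \<le> p n i" "p n i \<le> 1" for n i
    using prob_space.prob_le_1[OF Q(1)] by (auto simp: p_def)
  have GL: "G n \<in> L2_fun M" for n
  proof (rule L2_fun_bounded[OF finite_measure_axioms])
    interpret Qn: prob_space "Q n" by (rule Q)
    have "(\<lambda>z. f (T (snd z) (fst z))) \<in> borel_measurable (M \<Otimes>\<^sub>M borel)"
      using measurable_compose[OF measurable_pair_swap', of "\<lambda>z. f (T (fst z) (snd z))"]
      by (simp add: case_prod_beta')
    then show "G n \<in> borel_measurable M"
      unfolding G_def by measurable
    show "cmod (G n x) \<le> B" for x
      unfolding G_def by (rule Qn.integral_norm_le_const) (use f B0 in auto)
  qed
  have vL: "v n \<in> L2_fun M" for n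
  proof (rule L2_fun_bounded[OF finite_measure_axioms])
    show "v n \<in> borel_measurable M" unfolding v_def by measurable
    show "cmod (v n x) \<le> (\<Sum>i<m. B)" for x
      unfolding v_def
    proof (rule sum_norm_le)
      show "norm (p n i *\<^sub>R f (T (ks ! i) x)) \<le> B" for i
        using mult_mono[OF p01(2)[of n i] f(2)[of "T (ks ! i) x"]] p01(1)[of n i] by simp
    qed
  qed
  \<comment> \<open>Replacing \<open>f \<circ> T j\<close> by its net member costs less than
    \<open>\<delta>\<close> for each \<open>j\<close>, hence at most \<open>\<delta>\<close> on
    average, and the new average is \<open>v n\<close>.\<close>
  have Gv: "L2_gap M (G n) (v n) \<le> \<delta>" for n
  proof -
    interpret Qn: prob_space "Q n" by (rule Q)
    have spQ: "space (Q n) = UNIV" using sets_eq_imp_space_eq[OF Q(2)[of n]] by simp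
    define u where "u j x = f (T (ks ! idx j) x)" for j x
    have u: "u j x = (\<Sum>i<m. indicator {j. idx j = i} j *\<^sub>R f (T (ks ! i) x))" for j x
    proof -
      have "(\<Sum>i<m. indicator {j. idx j = i} j *\<^sub>R f (T (ks ! i) x))
          = (\<Sum>i<m. if i = idx j then f (T (ks ! i) x) else 0)"
        by (intro sum.cong) auto
      then show ?thesis using idx(1)[of j] by (simp add: u_def)
    qed
    have "(LINT j|Q n. u j x) = v n x" for x
    proof -
      have "(LINT j|Q n. u j x) = (\<Sum>i<m. LINT j|Q n. indicator {j. idx j = i} j *\<^sub>R f (T (ks ! i) x))"
        unfolding u
        by (rule Bochner_Integration.integral_sum)
           (auto intro!: integrable_scaleR_left integrable_real_indicator simp: Qn.emeasure_eq_measure)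
      moreover have "integrable (Q n) (indicator {j. idx j = i} :: 'g \<Rightarrow> real)" for i
        by (intro integrable_real_indicator) (auto simp: Qn.emeasure_eq_measure)
      ultimately show ?thesis by (simp add: v_def p_def spQ)
    qed
    moreover have "L2_gap M (\<lambda>x. LINT j|Q n. f (T j x)) (\<lambda>x. LINT j|Q n. u j x) \<le> \<delta>"
    proof (rule L2_gap_average_le[OF Q(1) prob_space_axioms])
      show "(\<lambda>(j, x). f (T j x)) \<in> borel_measurable (Q n \<Otimes>\<^sub>M M)" by (simp add: case_prod_beta')
      show "(\<lambda>(j, x). u j x) \<in> borel_measurable (Q n \<Otimes>\<^sub>M M)"
        unfolding u case_prod_beta' by measurable
      show "AE j in Q n. L2_gap M (\<lambda>x. f (T j x)) (u j) \<le> \<delta>"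
        using idx(2) by (intro AE_I2) (auto simp: u_def[abs_def] o_def L2_gap_commute less_imp_le)
    qed (use f \<delta> in \<open>auto simp: u_def\<close>)
    ultimately show ?thesis by (simp add: G_def[abs_def])
  qed
  \<comment> \<open>If all \<open>m\<close> coefficients agree up to \<open>\<eta>\<close>, the
    combinations differ by at most \<open>m * \<eta> * B\<close>, which is at most
    \<open>\<delta>\<close>. The summand 1 keeps the divisor positive.\<close>
  define \<eta> where "\<eta> = \<delta> / (real m * B + 1)"
  have mB: "0 < real m * B + 1" using B0 by (simp add: add_nonneg_pos)
  then have \<eta>: "0 < \<eta>" using \<delta> by (simp add: \<eta>_def)
  \<comment> \<open>Rounding the coefficients to the grid of mesh \<open>\<eta>\<close> leaves
    finitely many codes; one index for each code that occurs gives the net.\<close>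
  define code where "code n = map (\<lambda>i. \<lfloor>p n i / \<eta>\<rfloor>) [0..<m]" for n
  have "range code \<subseteq> {xs. set xs \<subseteq> {0..\<lfloor>1 / \<eta>\<rfloor>} \<and> length xs = m}"
    using p01 \<eta> by (auto simp: code_def intro!: floor_mono divide_right_mono)
  then have "finite (range code)"
    by (rule finite_subset) (rule finite_lists_length_eq, simp)
  from finite_subset_image[OF this subset_refl] obtain N where N: "finite N" "range code = code ` N" by blast
  have "\<exists>k\<in>N. L2_gap M (G k) (G n) < e" for n
  proof -
    obtain k where k: "k \<in> N" "code k = code n" using N(2) by (metis imageE rangeI)
    have close: "\<bar>p k i - p n i\<bar> \<le> \<eta>" if "i < m" for i
    proof -
      have "\<lfloor>p k i / \<eta>\<rfloor> = \<lfloor>p n i / \<eta>\<rfloor>" using k(2) that by (simp add: code_def)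
      then have "\<bar>p k i / \<eta> - p n i / \<eta>\<bar> \<le> 1" by linarith
      then have "\<bar>p k i - p n i\<bar> / \<eta> \<le> 1" using \<eta> by (simp add: diff_divide_distrib[symmetric])
      then show ?thesis using \<eta> by simp
    qed
    have "L2_gap M (v k) (v n) \<le> \<delta>"
    proof (rule L2_gap_le_const)
      fix x
      have "v k x - v n x = (\<Sum>i<m. (p k i - p n i) *\<^sub>R f (T (ks ! i) x))"
        by (simp add: v_def sum_subtractf scaleR_diff_left)
      also have "cmod \<dots> \<le> (\<Sum>i<m. \<eta> * B)"
        using close f(2) by (intro sum_norm_le) (auto intro!: mult_mono simp: \<eta> less_imp_le)
      also have "\<dots> \<le> \<eta> * (real m * B + 1)" using \<eta> by (simp add: algebra_simps)
      also have "\<dots> = \<delta>" using mB by (simp add: \<eta>_def)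
      finally show "cmod (v k x - v n x) \<le> \<delta>" .
    qed (use \<delta> in simp)
    then have "L2_gap M (G k) (G n) \<le> 3 * \<delta>"
      using L2_gap_triangle[OF GL[of k] vL[of k] GL[of n]]
        L2_gap_triangle[OF vL[of k] vL[of n] GL[of n]] Gv[of k] Gv[of n]
        L2_gap_commute[of M "v n" "G n"]
      by linarith
    then show ?thesis using k(1) e by (intro bexI[of _ k]) (auto simp: \<delta>_def)
  qed
  then show ?thesis using N(1) by (auto simp: G_def[abs_def])
qed

end

section \<open>Lipschitz approximation of almost periodic functions\<close>

lemma real_limsup_bounded:
  fixes a :: "nat \<Rightarrow> real"
  assumes "\<And>n. \<bar>a n\<bar> \<le> B"
  shows "\<bar>limsup (\<lambda>n. ereal (a n))\<bar> \<noteq> \<infinity>" "\<bar>real_of_ereal (limsup (\<lambda>n. ereal (a n)))\<bar> \<le> B"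
proof -
  have "- B \<le> a n" "a n \<le> B" for n using assms[of n] by auto
  then have "ereal (- B) \<le> limsup (\<lambda>n. ereal (a n))" "limsup (\<lambda>n. ereal (a n)) \<le> ereal B"
    by (intro le_Limsup Limsup_bounded always_eventually allI; simp)+
  then show "\<bar>limsup (\<lambda>n. ereal (a n))\<bar> \<noteq> \<infinity>" "\<bar>real_of_ereal (limsup (\<lambda>n. ereal (a n)))\<bar> \<le> B"
    by (cases "limsup (\<lambda>n. ereal (a n))"; simp)+
qed

lemma real_limsup_le_add:
  fixes a b :: "nat \<Rightarrow> real"
  assumes a: "\<And>n. \<bar>a n\<bar> \<le> B" and b: "\<And>n. \<bar>b n\<bar> \<le> B"
    and le: "\<And>e. 0 < e \<Longrightarrow> \<forall>\<^sub>F n in sequentially. a n \<le> b n + (D + e)"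
  shows "real_of_ereal (limsup (\<lambda>n. ereal (a n))) \<le> real_of_ereal (limsup (\<lambda>n. ereal (b n))) + D"
proof (rule field_le_epsilon)
  fix e :: real assume "0 < e"
  have "limsup (\<lambda>n. ereal (a n)) \<le> limsup (\<lambda>n. ereal (b n) + ereal (D + e))"
    by (rule Limsup_mono) (use le[OF \<open>0 < e\<close>] in simp)
  also have "\<dots> = limsup (\<lambda>n. ereal (b n)) + ereal (D + e)"
    by (rule Limsup_add_ereal_right) auto
  finally show "real_of_ereal (limsup (\<lambda>n. ereal (a n))) \<le> real_of_ereal (limsup (\<lambda>n. ereal (b n))) + D + e"
    using real_limsup_bounded(1)[of a, OF a] real_limsup_bounded(1)[of b, OF b]
    by (cases "limsup (\<lambda>n. ereal (a n))"; cases "limsup (\<lambda>n. ereal (b n))") auto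
qed

text \<open>A substitute for the limit that agrees with it where it exists and, for bounded
  sequences, still respects estimates of differences where it does not. Upper limits are taken in
  real and imaginary part separately; boundedness keeps them finite, so that
  \<open>real_of_ereal\<close> does not return its default value.\<close>

definition complex_limsup :: "(nat \<Rightarrow> complex) \<Rightarrow> complex" where
  "complex_limsup a = Complex (real_of_ereal (limsup (\<lambda>n. ereal (Re (a n)))))
     (real_of_ereal (limsup (\<lambda>n. ereal (Im (a n)))))"

lemma complex_limsup_eq_lim:
  assumes "a \<longlonglongrightarrow> l" shows "complex_limsup a = l"
proof -
  have "limsup (\<lambda>n. ereal (Re (a n))) = ereal (Re l)" "limsup (\<lambda>n. ereal (Im (a n))) = ereal (Im l)"
    by (intro lim_imp_Limsup tendsto_intros assms; simp)+
  then show ?thesis by (simp add: complex_limsup_def)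
qed

lemma complex_limsup_bounded:
  assumes "\<And>n. cmod (a n) \<le> B" shows "cmod (complex_limsup a) \<le> 2 * B"
proof -
  have "\<bar>Re (a n)\<bar> \<le> B" "\<bar>Im (a n)\<bar> \<le> B" for n
    using assms[of n] abs_Re_le_cmod[of "a n"] abs_Im_le_cmod[of "a n"] by auto
  from real_limsup_bounded(2)[of "\<lambda>n. Re (a n)", OF this(1)]
    real_limsup_bounded(2)[of "\<lambda>n. Im (a n)", OF this(2)]
  have "\<bar>Re (complex_limsup a)\<bar> \<le> B" "\<bar>Im (complex_limsup a)\<bar> \<le> B"
    by (simp_all only: complex_limsup_def complex.sel)
  then show ?thesis
    using cmod_le[of "complex_limsup a"] by linarith
qed

text \<open>Monotonicity of the upper limit, used in both directions, bounds the real and the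
  imaginary part of the difference by \<open>D\<close>; the factor 2 comes from adding them.\<close>

lemma complex_limsup_diff_le:
  assumes "\<And>n. cmod (a n) \<le> B" "\<And>n. cmod (b n) \<le> B"
    and le: "\<And>e. 0 < e \<Longrightarrow> \<forall>\<^sub>F n in sequentially. cmod (a n - b n) \<le> D + e"
  shows "cmod (complex_limsup a - complex_limsup b) \<le> 2 * D"
proof -
  have bd: "\<bar>Re (a n)\<bar> \<le> B" "\<bar>Im (a n)\<bar> \<le> B" "\<bar>Re (b n)\<bar> \<le> B" "\<bar>Im (b n)\<bar> \<le> B" for n
    using assms(1,2)[of n] abs_Re_le_cmod[of "a n"] abs_Im_le_cmod[of "a n"]
      abs_Re_le_cmod[of "b n"] abs_Im_le_cmod[of "b n"] by auto
  have parts: "Re (a n) \<le> Re (b n) + d \<and> Re (b n) \<le> Re (a n) + d \<and>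
      Im (a n) \<le> Im (b n) + d \<and> Im (b n) \<le> Im (a n) + d" if "cmod (a n - b n) \<le> d" for n d
    using that abs_Re_le_cmod[of "a n - b n"] abs_Im_le_cmod[of "a n - b n"] by auto
  have ev: "\<forall>\<^sub>F n in sequentially. Re (a n) \<le> Re (b n) + (D + e)"
      "\<forall>\<^sub>F n in sequentially. Re (b n) \<le> Re (a n) + (D + e)"
      "\<forall>\<^sub>F n in sequentially. Im (a n) \<le> Im (b n) + (D + e)"
      "\<forall>\<^sub>F n in sequentially. Im (b n) \<le> Im (a n) + (D + e)" if "0 < e" for e
    using le[OF that] by (auto elim!: eventually_mono dest: parts)
  note bounds = real_limsup_le_add[of "\<lambda>n. Re (a n)" B "\<lambda>n. Re (b n)" D, OF bd(1,3) ev(1)]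
    real_limsup_le_add[of "\<lambda>n. Re (b n)" B "\<lambda>n. Re (a n)" D, OF bd(3,1) ev(2)]
    real_limsup_le_add[of "\<lambda>n. Im (a n)" B "\<lambda>n. Im (b n)" D, OF bd(2,4) ev(3)]
    real_limsup_le_add[of "\<lambda>n. Im (b n)" B "\<lambda>n. Im (a n)" D, OF bd(4,2) ev(4)]
  have "\<bar>Re (complex_limsup a - complex_limsup b)\<bar> \<le> D"
    unfolding complex_limsup_def minus_complex.sel complex.sel using bounds(1,2) by linarith
  moreover have "\<bar>Im (complex_limsup a - complex_limsup b)\<bar> \<le> D"
    unfolding complex_limsup_def minus_complex.sel complex.sel using bounds(3,4) by linarith
  ultimately show ?thesis using cmod_le[of "complex_limsup a - complex_limsup b"] by simp
qed

lemma borel_measurable_complex_limsup: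
  fixes a :: "nat \<Rightarrow> 'x \<Rightarrow> complex"
  assumes [measurable]: "\<And>n. a n \<in> borel_measurable M"
  shows "(\<lambda>x. complex_limsup (\<lambda>n. a n x)) \<in> borel_measurable M"
  unfolding complex_limsup_def by (simp add: borel_measurable_complex_iff) measurable

text \<open>Induction over \<open>K\<close>: balls of radius \<open>\<delta>/2\<close> around a
  countable dense set cover the complex plane, so one of their preimages under \<open>h k\<close>
  meets the current set in a non-null set.\<close>

lemma ex_small_oscillation:
  fixes h :: "'k \<Rightarrow> 'x \<Rightarrow> complex"
  assumes "finite K" "\<And>k. k \<in> K \<Longrightarrow> h k \<in> borel_measurable M" "0 < \<delta>"
    and "S \<in> sets M" "S \<notin> null_sets M"
  shows "\<exists>A\<in>sets M. A \<notin> null_sets M \<and> A \<subseteq> S \<and> (\<forall>x\<in>A. \<forall>y\<in>A. \<forall>k\<in>K. cmod (h k x - h k y) \<le> \<delta>)"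
  using assms(1,2)
proof (induction K rule: finite_induct)
  case empty
  then show ?case using assms by blast
next
  case (insert k K)
  then obtain A where A: "A \<in> sets M" "A \<notin> null_sets M" "A \<subseteq> S"
      "\<forall>x\<in>A. \<forall>y\<in>A. \<forall>k\<in>K. cmod (h k x - h k y) \<le> \<delta>" by auto
  obtain D :: "complex set" where D: "countable D" "\<And>X. open X \<Longrightarrow> X \<noteq> {} \<Longrightarrow> \<exists>d\<in>D. d \<in> X"
    using countable_dense_exists by blast
  define C where "C d = A \<inter> (h k -` ball d (\<delta>/2) \<inter> space M)" for d
  have C: "C d \<in> sets M" for d
    unfolding C_def using A(1) insert.prems[of k] by (auto intro: measurable_sets)
  have "A \<subseteq> (\<Union>d\<in>D. C d)"
  proof
    fix x assume x: "x \<in> A"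
    obtain d where "d \<in> D" "d \<in> ball (h k x) (\<delta>/2)" using D(2)[of "ball (h k x) (\<delta>/2)"] assms(3) by auto
    then show "x \<in> (\<Union>d\<in>D. C d)"
      using x sets.sets_into_space[OF A(1)] by (auto simp: C_def dist_commute)
  qed
  have "\<exists>d\<in>D. C d \<notin> null_sets M"
  proof (rule ccontr)
    assume "\<not> (\<exists>d\<in>D. C d \<notin> null_sets M)"
    then have "(\<Union>d\<in>D. C d) \<in> null_sets M" using D(1) by (intro null_sets_UN') auto
    then show False using A(1,2) \<open>A \<subseteq> (\<Union>d\<in>D. C d)\<close> null_sets_subset by blast
  qed
  then obtain d where d: "C d \<notin> null_sets M" by blast
  have "cmod (h k x - h k y) \<le> \<delta>" if "x \<in> C d" "y \<in> C d" for x y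
  proof -
    have "dist d (h k x) < \<delta>/2" "dist d (h k y) < \<delta>/2" using that by (auto simp: C_def)
    then show ?thesis using dist_triangle3[of "h k x" "h k y" d] by (simp add: dist_norm)
  qed
  then show ?case using C[of d] d A(3,4) by (intro bexI[of _ "C d"]) (auto simp: C_def)
qed

section \<open>Weights on the almost periods and the resulting Lipschitz averages\<close>

context folner_system
begin

text \<open>Positive exactly at the \<open>\<epsilon>\<close>-almost periods of \<open>f\<close>. A
  tent is used instead of an indicator function so that the weight is Lipschitz in the translation
  metric.\<close>

definition weight :: "('x \<Rightarrow> complex) \<Rightarrow> real \<Rightarrow> 'g \<Rightarrow> real" where
  "weight f \<epsilon> j = max 0 (\<epsilon> - L2_gap M (f \<circ> T j) f)"

lemma weight_bounds: "0 \<le> weight f \<epsilon> j" "0 \<le> \<epsilon> \<Longrightarrow> weight f \<epsilon> j \<le> \<epsilon>"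
  by (auto simp: weight_def)

lemma weight_measurable [measurable]:
  assumes [measurable]: "f \<in> borel_measurable M"
  shows "weight f \<epsilon> \<in> borel_measurable borel"
  unfolding weight_def by measurable

lemma L2_gap_translate_diff:
  assumes "f \<in> L2_fun M"
  shows "L2_gap M (f \<circ> T (j - k)) (f \<circ> T (j - k')) = L2_gap M (f \<circ> T k) (f \<circ> T k')"
proof -
  have m: "f \<in> borel_measurable M" using assms by (rule L2_fun_measurable)
  \<comment> \<open>Translation by \<open>k + k' - j\<close> takes \<open>j - k\<close> to
    \<open>k'\<close> and \<open>j - k'\<close> to \<open>k\<close>; symmetry of the distance
    restores the order.\<close>
  have e: "j - k + (k + k' - j) = k'" "j - k' + (k + k' - j) = k" by (simp_all add: algebra_simps)
  have "L2_gap M (f \<circ> T (j - k)) (f \<circ> T (j - k')) = L2_gap M (f \<circ> T k') (f \<circ> T k)"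
    using L2_gap_translate[OF m m, of "j - k" "k + k' - j" "j - k'"] unfolding e by simp
  then show ?thesis by (simp add: L2_gap_commute)
qed

lemma weight_translate_diff:
  assumes f: "f \<in> L2_fun M"
  shows "\<bar>weight f \<epsilon> (j - k) - weight f \<epsilon> (j - k')\<bar> \<le> L2_gap M (f \<circ> T k) (f \<circ> T k')"
proof -
  let ?a = "L2_gap M (f \<circ> T (j - k)) f" and ?b = "L2_gap M (f \<circ> T (j - k')) f"
    and ?d = "L2_gap M (f \<circ> T (j - k)) (f \<circ> T (j - k'))"
  have fT: "f \<circ> T i \<in> L2_fun M" for i using f by (rule L2_fun_comp_T)
  have "?a \<le> ?d + ?b" "?b \<le> ?d + ?a"
    using L2_gap_triangle[OF fT[of "j - k"] fT[of "j - k'"] f]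
      L2_gap_triangle[OF fT[of "j - k'"] fT[of "j - k"] f]
      L2_gap_commute[of M "f \<circ> T (j - k)" "f \<circ> T (j - k')"] by simp_all
  then have "\<bar>weight f \<epsilon> (j - k) - weight f \<epsilon> (j - k')\<bar> \<le> ?d" by (auto simp: weight_def)
  then show ?thesis by (simp only: L2_gap_translate_diff[OF f])
qed

text \<open>Finitely many translates of the weight have a sum bounded below, so its means cannot vanish.\<close>

lemma weight_average_bounded_below:
  assumes f: "f \<in> L2_fun M" and \<epsilon>: "0 < \<epsilon>"
    and K: "finite K" "\<And>j. \<exists>k\<in>K. L2_gap M (f \<circ> T k) (f \<circ> T j) < \<epsilon> / 2"
  shows "\<exists>c>0. \<forall>\<^sub>F n in sequentially. c \<le> (LINT j|P n. weight f \<epsilon> j)"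
proof -
  have fm [measurable]: "f \<in> borel_measurable M" using f by (rule L2_fun_measurable)
  let ?w = "weight f \<epsilon>" and ?c = "\<lambda>n. LINT j|P n. weight f \<epsilon> j"
  have cardK: "0 < card K" using K by (auto simp: card_gt_0_iff)
  have sh [measurable]: "(\<lambda>j. ?w (j + - k)) \<in> borel_measurable borel" for k
    using measurable_compose[OF translate_measurable[of "- k"] weight_measurable[OF fm, of \<epsilon>]] by (simp add: add.commute)
  have [measurable]: "(\<lambda>j. ?w (j - k)) \<in> borel_measurable borel" for k
    using sh[of k] by simp
  have int: "integrable (P n) (\<lambda>j. ?w (j + - k))" for n k
    by (rule P.integrable_const_bound[where B=\<epsilon>]) (use weight_bounds \<epsilon> in \<open>auto intro!: AE_I2\<close>)
  have "(\<lambda>n. \<Sum>k\<in>K. (LINT j|P n. ?w (j + - k)) - ?c n) \<longlonglongrightarrow> (\<Sum>k\<in>K. 0)"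
    by (intro tendsto_sum folner_average_translate[where C=\<epsilon>])
       (use weight_bounds[where f=f and \<epsilon>=\<epsilon>] \<epsilon> in auto)
  then have "\<forall>\<^sub>F n in sequentially. (\<Sum>k\<in>K. (LINT j|P n. ?w (j + - k)) - ?c n) < \<epsilon> / 4"
    using \<epsilon> by (intro order_tendstoD) auto
  \<comment> \<open>Origin of the constant: the shifted means sum to at least
    \<open>\<epsilon> / 2\<close>, and eventually this sum exceeds \<open>card K\<close> copies of
    the mean \<open>?c n\<close> by less than \<open>\<epsilon> / 4\<close>.\<close>
  then have "\<forall>\<^sub>F n in sequentially. \<epsilon> / 4 / card K \<le> ?c n"
  proof eventually_elim
    case (elim n)
    \<comment> \<open>For every \<open>j\<close> some net member \<open>k\<close> puts
      \<open>f \<circ> T (j - k)\<close> within \<open>\<epsilon> / 2\<close> of \<open>f\<close>,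
      so at least one summand is \<open>\<epsilon> / 2\<close> or more.\<close>
    have "\<epsilon> / 2 = (LINT j|P n. \<epsilon> / 2)" using P.prob_space[of n] by simp
    also have "\<dots> \<le> (LINT j|P n. (\<Sum>k\<in>K. ?w (j + - k)))"
    proof (rule integral_mono)
      fix j
      obtain k where k: "k \<in> K" "L2_gap M (f \<circ> T k) (f \<circ> T j) < \<epsilon> / 2" using K(2) by blast
      have "L2_gap M (f \<circ> T (j - k)) (f \<circ> T (j - j)) = L2_gap M (f \<circ> T k) (f \<circ> T j)"
        by (rule L2_gap_translate_diff[OF f])
      moreover have "L2_gap M (f \<circ> T (j - k)) (f \<circ> T (j - j)) = L2_gap M (f \<circ> T (j - k)) f"
        unfolding L2_gap_def by (simp add: action_zero cong: Bochner_Integration.integral_cong)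
      ultimately have "L2_gap M (f \<circ> T (j + - k)) f < \<epsilon> / 2" using k(2) by simp
      then have "\<epsilon> / 2 \<le> ?w (j + - k)" unfolding weight_def by linarith
      also have "\<dots> \<le> (\<Sum>k\<in>K. ?w (j + - k))"
        using K(1) k(1) by (intro member_le_sum) (auto simp: weight_bounds)
      finally show "\<epsilon> / 2 \<le> (\<Sum>k\<in>K. ?w (j + - k))" .
    qed (use int in \<open>auto intro!: Bochner_Integration.integrable_sum simp del: add_uminus_conv_diff\<close>)
    also have "\<dots> = (\<Sum>k\<in>K. (LINT j|P n. ?w (j + - k)))"
      by (rule Bochner_Integration.integral_sum) (rule int)
    also have "\<dots> = (\<Sum>k\<in>K. (LINT j|P n. ?w (j + - k)) - ?c n) + card K * ?c n"
      by (simp add: sum_subtractf)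
    finally have "\<epsilon> / 4 \<le> card K * ?c n" using elim by linarith
    then show ?case using cardK by (simp add: field_simps)
  qed
  then show ?thesis using \<epsilon> cardK by (intro exI[of _ "\<epsilon> / 4 / card K"]) auto
qed

text \<open>
  The approximation \<open>g\<close> is an \<open>L\<^sup>2\<close> limit point of the weighted averages
  \<open>G\<^sub>n = (1 / c\<^sub>n) \<integral> w(j) f \<circ> T\<^sup>j dP\<^sub>n(j)\<close>. By the Folner property, shifting the argument of
  \<open>G\<^sub>n\<close> amounts to shifting the weight, and the weight is Lipschitz in the translation
  metric of \<open>f\<close>. Taking upper limits instead of limits makes this estimate valid at every point,
  whereas \<open>f\<close> itself satisfies it only in the mean.
\<close>

lemma ex_Lipschitz_approximation:
  assumes fm: "f \<in> borel_measurable M" and fB: "\<And>x. cmod (f x) \<le> B"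
    and net: "\<And>e. 0 < e \<Longrightarrow> \<exists>K. finite K \<and> (\<forall>j. \<exists>k\<in>K. L2_gap M (f \<circ> T k) (f \<circ> T j) < e)"
    and \<epsilon>: "0 < \<epsilon>"
  obtains g C where "g \<in> borel_measurable M" "\<And>x. cmod (g x) \<le> 2 * B" "L2_gap M f g \<le> \<epsilon>" "0 \<le> C"
    "\<And>x k k'. x \<in> space M \<Longrightarrow> cmod (g (T k x) - g (T k' x)) \<le> C * L2_gap M (f \<circ> T k) (f \<circ> T k')"
proof -
  note [measurable] = fm
  let ?w = "weight f \<epsilon>"
  have B0: "0 \<le> B" using fB norm_ge_zero order_trans by blast
  have f: "f \<in> L2_fun M" using L2_fun_bounded[OF finite_measure_axioms fm, of B] fB by simp
  obtain K where "finite K" "\<And>j. \<exists>k\<in>K. L2_gap M (f \<circ> T k) (f \<circ> T j) < \<epsilon> / 2"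
    using net[of "\<epsilon> / 2"] \<epsilon> by auto
  from weight_average_bounded_below[OF f \<epsilon> this]
  obtain c n0 where c: "0 < c" "\<And>n. n0 \<le> n \<Longrightarrow> c \<le> (LINT j|P n. ?w j)"
    by (auto simp: eventually_sequentially)
  \<comment> \<open>Starting at \<open>n0\<close> makes the lower bound \<open>c\<close> valid for
    every index.\<close>
  define cn where "cn n = (LINT j|P (n + n0). ?w j)" for n
  have cn: "c \<le> cn n" "0 < cn n" for n using c(2)[of "n + n0"] c(1) by (auto simp: cn_def)
  have w_int: "integrable (P n) ?w" for n
    by (rule P.integrable_const_bound[where B=\<epsilon>]) (use weight_bounds[where f=f and \<epsilon>=\<epsilon>] \<epsilon> in \<open>auto intro!: AE_I2\<close>)
  \<comment> \<open>Normalising the weight gives probability measures, so the weighted averages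
    \<open>G n\<close> are plain averages of the orbit with respect to \<open>Q n\<close>.\<close>
  define Q where "Q n = density (P (n + n0)) (\<lambda>j. ennreal (?w j / cn n))" for n
  have Q: "prob_space (Q n)" for n
  proof (rule prob_spaceI)
    have "emeasure (Q n) (space (Q n)) = (\<integral>\<^sup>+j. ennreal (?w j / cn n) \<partial>P (n + n0))"
      unfolding Q_def by (simp add: emeasure_density)
    also have "\<dots> = ennreal (LINT j|P (n + n0). ?w j / cn n)"
      by (rule nn_integral_eq_integral)
         (use w_int weight_bounds(1)[of f \<epsilon>] cn(2)[of n] in \<open>auto intro!: AE_I2 divide_nonneg_pos\<close>)
    also have "(LINT j|P (n + n0). ?w j / cn n) = 1" using cn(2)[of n] by (simp add: cn_def)
    finally show "emeasure (Q n) (space (Q n)) = 1" by simp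
  qed
  have setsQ: "sets (Q n) = sets borel" for n by (simp add: Q_def)
  note [measurable_cong] = setsQ
  define G where "G n x = (LINT j|Q n. f (T j x))" for n x
  have G_eq: "G n x = (1 / cn n) *\<^sub>R (LINT j|P (n + n0). ?w j *\<^sub>R f (T j x))" if x: "x \<in> space M" for n x
  proof -
    have [measurable]: "(\<lambda>j. f (T j x)) \<in> borel_measurable borel" by (rule borel_measurable_orbit[OF fm x])
    have "G n x = (LINT j|P (n + n0). (1 / cn n) *\<^sub>R (?w j *\<^sub>R f (T j x)))"
      unfolding G_def Q_def
      by (subst integral_density)
         (use weight_bounds(1)[of f \<epsilon>] cn(2)[of n] in \<open>auto intro!: AE_I2 divide_nonneg_pos simp: divide_inverse mult.commute\<close>)
    then show ?thesis by (simp only: integral_scaleR_right)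
  qed
  have GB: "cmod (G n x) \<le> B" for n x
  proof -
    interpret Qn: prob_space "Q n" by (rule Q)
    show ?thesis unfolding G_def by (rule Qn.integral_norm_le_const) (use fB B0 in auto)
  qed
  have act [measurable]: "(\<lambda>z. f (T (fst z) (snd z))) \<in> borel_measurable (borel \<Otimes>\<^sub>M M)"
    using measurable_action_comp[of f borel] fm by (simp add: case_prod_beta')
  have Gm [measurable]: "G n \<in> borel_measurable M" for n
  proof -
    interpret Qn: prob_space "Q n" by (rule Q)
    have [measurable]: "(\<lambda>z. f (T (snd z) (fst z))) \<in> borel_measurable (M \<Otimes>\<^sub>M borel)"
      using measurable_compose[OF measurable_pair_swap' act] by (simp add: case_prod_beta')
    show ?thesis unfolding G_def[abs_def] by measurable
  qed
  have GL: "G n \<in> L2_fun M" for n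
    using L2_fun_bounded[OF finite_measure_axioms Gm, of n B] GB by simp
  have Gf: "L2_gap M (G n) f \<le> \<epsilon>" for n
  proof -
    interpret Qn: prob_space "Q n" by (rule Q)
    have "L2_gap M (\<lambda>x. LINT j|Q n. f (T j x)) (\<lambda>x. LINT j|Q n. f x) \<le> \<epsilon>"
    proof (rule L2_gap_average_le[OF Q prob_space_axioms])
      show "(\<lambda>(j, x). f (T j x)) \<in> borel_measurable (Q n \<Otimes>\<^sub>M M)" by (simp add: case_prod_beta')
      show "(\<lambda>(j, x). f x) \<in> borel_measurable (Q n \<Otimes>\<^sub>M M)" by (simp add: case_prod_beta')
      \<comment> \<open>The density vanishes unless \<open>f \<circ> T j\<close> is closer to
        \<open>f\<close> than \<open>\<epsilon>\<close>.\<close>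
      show "AE j in Q n. L2_gap M (\<lambda>x. f (T j x)) f \<le> \<epsilon>"
      proof -
        have m: "(\<lambda>j. ennreal (?w j / cn n)) \<in> borel_measurable (P (n + n0))" by measurable
        show ?thesis
          unfolding Q_def AE_density[OF m] using cn(2)[of n]
          by (auto intro!: AE_I2 simp: weight_def o_def zero_less_divide_iff split: if_splits)
      qed
    qed (use fB \<epsilon> in auto)
    then show ?thesis by (simp add: G_def[abs_def] Qn.prob_space)
  qed
  obtain r g0 where r: "strict_mono r" and g0: "g0 \<in> L2_fun M"
    and lim: "AE x in M. (\<lambda>n. G (r n) x) \<longlonglongrightarrow> g0 x" "(\<lambda>n. L2_gap M (G (r n)) g0) \<longlonglongrightarrow> 0"
    by (rule L2_totally_bounded_subseq[of G, OF GL])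
       (use orbit_averages_totally_bounded[OF fm fB Q setsQ net] in \<open>simp add: G_def[abs_def]\<close>)
  \<comment> \<open>The L2 limit \<open>g0\<close> is determined only up to null sets;
    \<open>g\<close> is a representative given at every point by the averages themselves.\<close>
  define g where "g x = complex_limsup (\<lambda>n. G (r n) x)" for x
  have gm: "g \<in> borel_measurable M"
    unfolding g_def[abs_def] by (rule borel_measurable_complex_limsup) (rule Gm)
  have gB: "cmod (g x) \<le> 2 * B" for x
    unfolding g_def by (rule complex_limsup_bounded) (rule GB)
  have g_eq: "AE x in M. g x = g0 x"
    using lim(1) by eventually_elim (simp add: g_def complex_limsup_eq_lim)
  have "L2_gap M f g0 \<le> \<epsilon>"
  proof -
    have "L2_gap M f g0 \<le> L2_gap M (G (r n)) g0 + \<epsilon>" for n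
      using L2_gap_triangle[OF f GL[of "r n"] g0] Gf[of "r n"] L2_gap_commute[of M f "G (r n)"] by linarith
    then show ?thesis
      using tendsto_lowerbound[OF tendsto_add[OF lim(2) tendsto_const[of \<epsilon>]], of "L2_gap M f g0"] by simp
  qed
  moreover have "L2_gap M f g = L2_gap M f g0"
    unfolding L2_gap_def
  proof (intro arg_cong[of _ _ sqrt] integral_cong_AE)
    show "AE x in M. (cmod (f x - g x))\<^sup>2 = (cmod (f x - g0 x))\<^sup>2"
      using g_eq by eventually_elim simp
  qed (use gm L2_fun_measurable[OF g0] in measurable)
  ultimately have gap: "L2_gap M f g \<le> \<epsilon>" by simp
  have lip: "cmod (g (T k x) - g (T k' x)) \<le> (2 * (B / c)) * L2_gap M (f \<circ> T k) (f \<circ> T k')"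
    if x: "x \<in> space M" for x k k'
  proof -
    let ?D = "L2_gap M (f \<circ> T k) (f \<circ> T k')"
    have [measurable]: "(\<lambda>j. f (T j x)) \<in> borel_measurable borel" by (rule borel_measurable_orbit[OF fm x])
    \<comment> \<open>The integrand of \<open>G n (T k x)\<close> at \<open>j\<close> is
      \<open>\<psi> k (j + k)\<close>. Dropping the shift costs the error \<open>R k\<close>, which
      tends to 0, and leaves \<open>k\<close> only in the argument of the weight.\<close>
    define \<psi> where "\<psi> k j = ?w (j - k) *\<^sub>R f (T j x)" for k j
    have [measurable]: "(\<lambda>j. ?w (j - k)) \<in> borel_measurable borel" for k
      using measurable_compose[OF translate_measurable[of "- k"] weight_measurable[OF fm, of \<epsilon>]] by simp
    have \<psi>m [measurable]: "\<psi> k \<in> borel_measurable borel" for k unfolding \<psi>_def by measurable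
    have \<psi>B: "cmod (\<psi> k j) \<le> \<epsilon> * B" for k j
      unfolding \<psi>_def norm_scaleR using weight_bounds[where f=f and \<epsilon>=\<epsilon> and j="j - k"] \<epsilon> fB B0
      by (intro mult_mono) auto
    have \<psi>I: "integrable (P n) (\<psi> k)" for n k
      by (rule P.integrable_const_bound[where B="\<epsilon> * B"]) (use \<psi>B in auto)
    define R where "R k n = (LINT j|P n. \<psi> k (j + k)) - (LINT j|P n. \<psi> k j)" for k n
    have R0: "R k \<longlonglongrightarrow> 0" for k
      unfolding R_def by (rule folner_average_translate[OF \<psi>m \<psi>B])
    have G_shift: "G n (T k x) = (1 / cn n) *\<^sub>R (R k (n + n0) + (LINT j|P (n + n0). \<psi> k j))" for n k
      using x by (simp add: G_eq T_space R_def \<psi>_def action_add)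
    have \<psi>diff: "cmod ((LINT j|P n. \<psi> k j) - (LINT j|P n. \<psi> k' j)) \<le> B * ?D" for n
    proof -
      have "(LINT j|P n. \<psi> k j) - (LINT j|P n. \<psi> k' j) = (LINT j|P n. \<psi> k j - \<psi> k' j)"
        using \<psi>I by simp
      also have "cmod \<dots> \<le> B * ?D"
      proof (rule P.integral_norm_le_const)
        fix j
        have "cmod (\<psi> k j - \<psi> k' j) = \<bar>?w (j - k) - ?w (j - k')\<bar> * cmod (f (T j x))"
          unfolding \<psi>_def scaleR_diff_left[symmetric] norm_scaleR ..
        also have "\<dots> \<le> ?D * B" using weight_translate_diff[OF f] fB by (intro mult_mono) auto
        finally show "cmod (\<psi> k j - \<psi> k' j) \<le> B * ?D" by (simp add: mult.commute)
      qed (use B0 in simp)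
      finally show ?thesis .
    qed
    have "\<forall>\<^sub>F n in sequentially. cmod (G (r n) (T k x) - G (r n) (T k' x)) \<le> B / c * ?D + e" if e: "0 < e" for e
    proof -
      have "(\<lambda>n. cmod (R k n) + cmod (R k' n)) \<longlonglongrightarrow> cmod 0 + cmod 0"
        by (intro tendsto_add tendsto_norm R0)
      \<comment> \<open>The threshold \<open>c * e\<close> becomes at most \<open>e\<close> after
        division by \<open>cn n\<close>, which is at least \<open>c\<close>.\<close>
      then have "\<forall>\<^sub>F n in sequentially. cmod (R k n) + cmod (R k' n) < c * e"
        using c(1) e by (intro order_tendstoD) auto
      then obtain N where N: "\<And>n. N \<le> n \<Longrightarrow> cmod (R k n) + cmod (R k' n) < c * e"
        by (auto simp: eventually_sequentially)
      have "cmod (G n (T k x) - G n (T k' x)) \<le> B / c * ?D + e" if "N \<le> n" for n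
      proof -
        let ?E = "(R k (n + n0) - R k' (n + n0)) + ((LINT j|P (n + n0). \<psi> k j) - (LINT j|P (n + n0). \<psi> k' j))"
        have "G n (T k x) - G n (T k' x) = (1 / cn n) *\<^sub>R ?E"
          unfolding G_shift scaleR_diff_right[symmetric] by (simp add: algebra_simps)
        then have "cmod (G n (T k x) - G n (T k' x)) = cmod ?E / cn n"
          using cn(2)[of n] by simp
        also have "\<dots> \<le> (c * e + B * ?D) / c"
        proof (rule frac_le)
          show "cmod ?E \<le> c * e + B * ?D"
            using N[of "n + n0"] that \<psi>diff[of "n + n0"]
              norm_triangle_ineq[of "R k (n + n0) - R k' (n + n0)" "(LINT j|P (n + n0). \<psi> k j) - (LINT j|P (n + n0). \<psi> k' j)"]
              norm_triangle_ineq4[of "R k (n + n0)" "R k' (n + n0)"] by simp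
        qed (use c(1) cn e B0 in auto)
        also have "\<dots> = B / c * ?D + e" using c(1) by (simp add: field_simps)
        finally show ?thesis .
      qed
      then show ?thesis
        using seq_suble[OF r] by (intro eventually_sequentiallyI[of N]) (meson order_trans)
    qed
    then have "cmod (complex_limsup (\<lambda>n. G (r n) (T k x)) - complex_limsup (\<lambda>n. G (r n) (T k' x)))
        \<le> 2 * (B / c * ?D)"
      by (intro complex_limsup_diff_le[of _ B]) (auto simp: GB)
    then show ?thesis by (simp add: g_def mult.assoc)
  qed
  show ?thesis
    by (rule that[of g "2 * (B / c)"]) (use gm gB gap lip B0 c in auto)
qed

end

section \<open>Almost periodicity excludes mean sensitivity\<close>

context folner_system
begin

text \<open>Truncation by the nearest-point projection onto a large disc. The projection is a
  contraction, so distances between translates do not grow and finite nets survive; convergence in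
  L2 is dominated convergence.\<close>

lemma ex_bounded_approximation:
  assumes f: "f \<in> L2_fun M" and e: "0 < e"
  obtains h B where "h \<in> borel_measurable M" "\<And>x. cmod (h x) \<le> B" "L2_gap M f h < e"
    "\<And>x y. cmod (h x - h y) \<le> cmod (f x - f y)"
proof -
  have [measurable]: "f \<in> borel_measurable M" using f by (rule L2_fun_measurable)
  define h where "h n x = closest_point (cball 0 (real n)) (f x)" for n x
  have ne: "cball (0::complex) (real n) \<noteq> {}" for n by simp
  have "continuous_on UNIV (closest_point (cball (0::complex) (real n)))" for n
    by (rule continuous_on_closest_point) auto
  then have [measurable]: "closest_point (cball (0::complex) (real n)) \<in> borel_measurable borel" for n
    by (rule borel_measurable_continuous_onI)
  have hm [measurable]: "h n \<in> borel_measurable M" for n unfolding h_def[abs_def] by measurable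
  have hB: "cmod (h n x) \<le> real n" for n x
    using closest_point_in_set[OF closed_cball ne, of n "f x"] by (simp add: h_def)
  have lip: "cmod (h n x - h n y) \<le> cmod (f x - f y)" for n x y
    using closest_point_lipschitz[OF convex_cball closed_cball ne, of n "f x" "f y"]
    by (simp add: h_def dist_norm)
  have lim: "(\<lambda>n. (cmod (f x - h n x))\<^sup>2) \<longlonglongrightarrow> 0" for x
  proof (rule tendsto_eventually, rule eventually_sequentiallyI)
    fix n assume "nat \<lceil>cmod (f x)\<rceil> \<le> n"
    then have "cmod (f x) \<le> real n" by linarith
    then have "h n x = f x" unfolding h_def by (intro closest_point_self) simp
    then show "(cmod (f x - h n x))\<^sup>2 = 0" by simp
  qed
  have "(\<lambda>n. LINT x|M. (cmod (f x - h n x))\<^sup>2) \<longlonglongrightarrow> (LINT x|M. 0)"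
  proof (rule integral_dominated_convergence[where w="\<lambda>x. (cmod (f x))\<^sup>2"])
    show "integrable M (\<lambda>x. (cmod (f x))\<^sup>2)" using f by (simp add: L2_fun_def)
    show "AE x in M. norm ((cmod (f x - h n x))\<^sup>2) \<le> (cmod (f x))\<^sup>2" for n
    proof (intro AE_I2)
      fix x
      have "cmod (f x - h n x) \<le> cmod (f x)"
        \<comment> \<open>The centre 0 belongs to the disc, so the nearest point is no farther from
          \<open>f x\<close> than 0 is.\<close>
        using closest_point_le[OF closed_cball, of 0 "0::complex" "real n" "f x"] by (simp add: h_def dist_norm)
      then show "norm ((cmod (f x - h n x))\<^sup>2) \<le> (cmod (f x))\<^sup>2" by (simp add: power_mono)
    qed
    show "AE x in M. (\<lambda>n. (cmod (f x - h n x))\<^sup>2) \<longlonglongrightarrow> 0" using lim by simp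
  qed simp_all
  then have "(\<lambda>n. L2_gap M f (h n)) \<longlonglongrightarrow> sqrt 0"
    unfolding L2_gap_def by (intro tendsto_real_sqrt) simp
  then have "\<forall>\<^sub>F n in sequentially. L2_gap M f (h n) < e"
    using e by (intro order_tendstoD) auto
  then obtain n where "L2_gap M f (h n) < e" by (auto simp: eventually_sequentially)
  then show ?thesis using that[of "h n" "real n"] hm hB lip by blast
qed

text \<open>The triangle inequality in L2 of \<open>P n\<close>, passing from \<open>f\<close> to
  \<open>g\<close> along the orbit of \<open>x\<close>, over to the orbit of \<open>y\<close>, and
  back to \<open>f\<close>. By genericity the two outer distances converge to
  \<open>L2_gap M f g\<close>, so they are eventually below \<open>s\<close>.\<close>

lemma d_mean_le_approximation:
  assumes f: "f \<in> L2_fun M" and gm: "g \<in> borel_measurable M" and gB: "\<And>x. cmod (g x) \<le> B"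
    and fg: "L2_gap M f g < s" and \<delta>: "0 \<le> \<delta>"
    and x: "x \<in> space M" "generic_point \<nu> F M T (\<lambda>z. (cmod (f z))\<^sup>2) x"
      "generic_point \<nu> F M T (\<lambda>z. (cmod (f z - g z))\<^sup>2) x"
    and y: "y \<in> space M" "generic_point \<nu> F M T (\<lambda>z. (cmod (f z))\<^sup>2) y"
      "generic_point \<nu> F M T (\<lambda>z. (cmod (f z - g z))\<^sup>2) y"
    and xy: "\<And>j. cmod (g (T j x) - g (T j y)) \<le> \<delta>"
  shows "d_mean \<nu> F T f x y \<le> ereal (2 * s + \<delta>)"
proof -
  have fm: "f \<in> borel_measurable M" using f by (rule L2_fun_measurable)
  have g: "g \<in> L2_fun M" using L2_fun_bounded[OF finite_measure_axioms gm, of B] gB by simp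
  let ?o = "\<lambda>h x j. h (T j x)"
  have go: "?o g z \<in> L2_fun (P n)" if "z \<in> space M" for z n
    by (rule L2_fun_bounded[OF P.finite_measure_axioms])
       (use borel_measurable_orbit[OF gm that] gB in auto)
  have fo: "?o f x \<in> L2_fun (P n)" "?o f y \<in> L2_fun (P n)" for n
    using L2_fun_orbit[OF f] x y by blast+
  have "(\<lambda>n. L2_gap (P n) (?o f x) (?o g x)) \<longlonglongrightarrow> L2_gap M f g"
       "(\<lambda>n. L2_gap (P n) (?o f y) (?o g y)) \<longlonglongrightarrow> L2_gap M f g"
    using generic_diff_tendsto_gap[OF f g] x y by blast+
  then have "\<forall>\<^sub>F n in sequentially. L2_gap (P n) (?o f x) (?o g x) < s"
      "\<forall>\<^sub>F n in sequentially. L2_gap (P n) (?o f y) (?o g y) < s"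
    using fg by (auto intro: order_tendstoD)
  then have "\<forall>\<^sub>F n in sequentially. L2_gap (P n) (?o f x) (?o f y) \<le> 2 * s + \<delta>"
  proof eventually_elim
    case (elim n)
    have "L2_gap (P n) (?o g x) (?o g y) \<le> \<delta>"
      using xy \<delta> by (intro P.L2_gap_le_const)
    then show ?case
      using elim L2_gap_triangle[OF fo(1) go[OF x(1)] fo(2), of n] L2_gap_triangle[OF go[OF x(1)] go[OF y(1)] fo(2), of n]
        L2_gap_commute[of "P n" "?o g y" "?o f y"] by linarith
  qed
  then show ?thesis
    unfolding d_mean_eq[OF fm x(1) y(1)] by (intro Limsup_bounded) simp
qed

lemma not_mean_sensitive_if_almost_periodic:
  assumes f: "f \<in> L2_fun M" and ap: "almost_periodic M T f"
  shows "\<not> mean_sensitive \<nu> F M T f"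
proof
  assume "mean_sensitive \<nu> F M T f"
  then obtain \<epsilon> where \<epsilon>: "0 < \<epsilon>" and ms: "\<And>A. A \<in> sets M \<Longrightarrow> measure M A > 0 \<Longrightarrow>
      \<exists>x\<in>A. \<exists>y\<in>A. generic_point \<nu> F M T (\<lambda>z. (cmod (f z))\<^sup>2) x \<and>
        generic_point \<nu> F M T (\<lambda>z. (cmod (f z))\<^sup>2) y \<and> d_mean \<nu> F T f x y > ereal \<epsilon>"
    unfolding mean_sensitive_def by blast
  \<comment> \<open>The final estimate is \<open>2 * (3 * e) + 3 * e\<close>, that is
    \<open>9 * e\<close>, which is below \<open>10 * e\<close>.\<close>
  define e where "e = \<epsilon> / 10"
  have e: "0 < e" using \<epsilon> by (simp add: e_def)
  obtain h B where h: "h \<in> borel_measurable M" "\<And>x. cmod (h x) \<le> B" "L2_gap M f h < e"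
    and hf: "\<And>x y. cmod (h x - h y) \<le> cmod (f x - f y)"
    by (rule ex_bounded_approximation[OF f e]) blast
  have hL: "h \<in> L2_fun M" using L2_fun_bounded[OF finite_measure_axioms h(1), of B] h(2) by simp
  have fT: "f \<circ> T j \<in> L2_fun M" for j using f by (rule L2_fun_comp_T)
  have net: "\<exists>K. finite K \<and> (\<forall>j. \<exists>k\<in>K. L2_gap M (h \<circ> T k) (h \<circ> T j) < d)" if d: "0 < d" for d
  proof -
    obtain K where K: "finite K" "\<forall>j. \<exists>k\<in>K. L2_gap M (f \<circ> T k) (f \<circ> T j) < d"
      using ap d unfolding almost_periodic_iff[of f T, OF fT] by blast
    have "L2_gap M (h \<circ> T k) (h \<circ> T j) \<le> L2_gap M (f \<circ> T k) (f \<circ> T j)" for k j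
      by (rule L2_gap_mono[OF fT fT]) (simp add: hf)
    then show ?thesis using K by (meson le_less_trans)
  qed
  obtain g C where g: "g \<in> borel_measurable M" "\<And>x. cmod (g x) \<le> 2 * B" "L2_gap M h g \<le> e" and C: "0 \<le> C"
    and lip: "\<And>x k k'. x \<in> space M \<Longrightarrow> cmod (g (T k x) - g (T k' x)) \<le> C * L2_gap M (h \<circ> T k) (h \<circ> T k')"
  proof (rule ex_Lipschitz_approximation[OF h(1,2) net e])
    fix g C
    assume "g \<in> borel_measurable M" "\<And>x. cmod (g x) \<le> 2 * B" "L2_gap M h g \<le> e" "0 \<le> C"
      "\<And>x k k'. x \<in> space M \<Longrightarrow> cmod (g (T k x) - g (T k' x)) \<le> C * L2_gap M (h \<circ> T k) (h \<circ> T k')"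
    then show thesis by (rule that)
  qed
  have gL: "g \<in> L2_fun M" using L2_fun_bounded[OF finite_measure_axioms g(1), of "2 * B"] g(2) by simp
  have fg: "L2_gap M f g < 3 * e"
    using L2_gap_triangle[OF f hL gL] h(3) g(3) e by linarith
  \<comment> \<open>The divisor \<open>C + 1\<close> also covers \<open>C = 0\<close>.\<close>
  have "0 < e / (C + 1)" using e C by simp
  from net[OF this] obtain K where K: "finite K" "\<And>j. \<exists>k\<in>K. L2_gap M (h \<circ> T k) (h \<circ> T j) < e / (C + 1)"
    by blast
  \<comment> \<open>The Lipschitz estimate holds at every point, so an L2 net for the orbit of
    \<open>h\<close> is a uniform net for the functions \<open>g \<circ> T j\<close>.\<close>
  have near: "\<exists>k\<in>K. \<forall>x\<in>space M. cmod (g (T k x) - g (T j x)) \<le> e" for j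
  proof -
    obtain k where k: "k \<in> K" "L2_gap M (h \<circ> T k) (h \<circ> T j) < e / (C + 1)" using K(2) by blast
    have "C * L2_gap M (h \<circ> T k) (h \<circ> T j) \<le> (C + 1) * (e / (C + 1))"
      using k(2) C e by (intro mult_mono) auto
    also have "\<dots> = e" using C by simp
    finally show ?thesis using k(1) lip by (intro bexI[of _ k] ballI) (auto intro: order_trans)
  qed
  have "space M \<notin> null_sets M" using emeasure_space_1 by auto
  moreover have "g \<circ> T k \<in> borel_measurable M" for k using measurable_comp[OF measurable_T g(1)] .
  ultimately obtain A0 where A0: "A0 \<in> sets M" "A0 \<notin> null_sets M"
      "\<And>x y k. x \<in> A0 \<Longrightarrow> y \<in> A0 \<Longrightarrow> k \<in> K \<Longrightarrow> cmod ((g \<circ> T k) x - (g \<circ> T k) y) \<le> e"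
    using ex_small_oscillation[OF K(1), of "\<lambda>k. g \<circ> T k" M e "space M"] e by auto
  obtain N where N: "N \<in> null_sets M" "{x\<in>space M. \<not> generic_point \<nu> F M T (\<lambda>z. (cmod (f z - g z))\<^sup>2) x} \<subseteq> N"
    using AE_generic_diff[OF f gL] unfolding eventually_ae_filter by blast
  \<comment> \<open>Sensitivity supplies points generic for the square of \<open>f\<close> only.
    Removing \<open>N\<close> in advance makes every point of \<open>A\<close> generic for the
    squared difference of \<open>f\<close> and \<open>g\<close> as well.\<close>
  define A where "A = A0 - N"
  have A: "A \<in> sets M" "0 < measure M A" "A \<subseteq> space M"
  proof -
    show "A \<in> sets M" using A0(1) N(1) by (auto simp: A_def)
    then show "A \<subseteq> space M" by (rule sets.sets_into_space)
    have "emeasure M A = emeasure M A0" unfolding A_def using N(1) A0(1) by (rule emeasure_Diff_null_set)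
    moreover have "emeasure M A0 \<noteq> 0" using A0 by (auto simp: null_sets_def)
    ultimately show "0 < measure M A" by (simp add: emeasure_eq_measure less_le)
  qed
  obtain x y where xy: "x \<in> A" "y \<in> A" "generic_point \<nu> F M T (\<lambda>z. (cmod (f z))\<^sup>2) x"
      "generic_point \<nu> F M T (\<lambda>z. (cmod (f z))\<^sup>2) y" "d_mean \<nu> F T f x y > ereal \<epsilon>"
    using ms[OF A(1,2)] by blast
  have xys: "x \<in> space M" "y \<in> space M" using xy A(3) by auto
  have gen: "generic_point \<nu> F M T (\<lambda>z. (cmod (f z - g z))\<^sup>2) z" if "z \<in> A" for z
    using that N(2) A(3) by (auto simp: A_def)
  have "cmod (g (T j x) - g (T j y)) \<le> 3 * e" for j
  proof -
    obtain k where k: "k \<in> K" "\<forall>x\<in>space M. cmod (g (T k x) - g (T j x)) \<le> e" using near by blast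
    have "cmod (g (T k x) - g (T k y)) \<le> e" using A0(3)[of x y k] xy(1,2) k(1) by (simp add: A_def)
    moreover have "cmod (g (T k x) - g (T j x)) \<le> e" "cmod (g (T k y) - g (T j y)) \<le> e"
      using k(2) xys by auto
    moreover have "cmod (g (T j x) - g (T j y)) \<le> cmod (g (T k x) - g (T k y)) + cmod (g (T k x) - g (T j x))
        + cmod (g (T k y) - g (T j y))"
      using norm_triangle_ineq4[of "g (T k x) - g (T k y)" "g (T k x) - g (T j x)"]
        norm_triangle_ineq[of "(g (T k x) - g (T k y)) - (g (T k x) - g (T j x))" "g (T k y) - g (T j y)"]
      by simp
    ultimately show ?thesis by linarith
  qed
  then have "d_mean \<nu> F T f x y \<le> ereal (2 * (3 * e) + 3 * e)"
    using e xy(3,4) gen[OF xy(1)] gen[OF xy(2)]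
    by (intro d_mean_le_approximation[OF f g(1,2) fg _ xys(1) _ _ xys(2)]) auto
  also have "\<dots> < ereal \<epsilon>" using \<epsilon> by (simp add: e_def)
  finally show False using xy(5) by simp
qed

end

theorem theorem1p15:
  fixes \<nu> :: "'g::{topological_ab_group_add, t2_space} measure"
    and F :: "nat \<Rightarrow> 'g set"
    and M :: "'x measure"
    and T :: "'g \<Rightarrow> 'x \<Rightarrow> 'x"
  assumes "locally_compact_space (euclidean :: 'g topology)"
    and "haar_measure \<nu>"
    and "folner_sequence \<nu> F"
    and "pointwise_ergodic \<nu> F"
    and "G_MPS M T"
    and "ergodic_action M T"
  shows "L2_fun M - H_ap M T = H_ms \<nu> F M T"
proof -
  interpret G_MPS M T by fact
  interpret folner_system M T \<nu> F
    using assms by unfold_locales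
  show ?thesis
    unfolding H_ap_def H_ms_def
    using almost_periodic_if_not_mean_sensitive not_mean_sensitive_if_almost_periodic by blast
qed

end
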